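(* Let $b\ge 0$ be an integer and let $\mathcal{F}$ be a family of graphs such that $box(G')\le b$ for every $G'\in\mathcal{F}$. Let $T(n)$ denote the time required to compute a $b$-dimensional box representation of a graph belonging to $\mathcal{F}$ on $n$ vertices. Let $G$ be an $\mathcal{F}+k_1e-k_2e$ graph on $n$ vertices and let $k=k_1+k_2$. Then, given a modulator of $G$, a box representation $\mathcal{B}$ of $G$ with $|\mathcal{B}|\le box(G)+2b$ can be computed in time $T(n)+O(n^2)+2^{O(k^2\log k)}$.
   Context: All graphs are finite and simple. A graph is an interval graph if one can assign to each vertex a closed interval of $\mathbb{R}$ such that two distinct vertices are adjacent iff their intervals intersect. For a graph $G(V,E)$, a box representation of $G$ of dimension $k$ is a collection $\mathcal{B}=\{I_1,\dots,I_k\}$ of interval graphs on vertex set $V$ with $E(G)=E(I_1)\cap\cdots\cap E(I_k)$; $|\mathcal{B}|$ denotes its dimension $k$. The boxicity $box(G)$ of an incomplete graph $G$ is the minimum $k$ such that $G$ has a box representation of dimension $k$; for a complete graph it is $0$. For a family $\mathcal{F}$ and integers $k_1,k_2\ge 0$, $\mathcal{F}+k_1e-k_2e$ is the family of graphs $G(V,E)$ for which there exist a set $E_{k_1}\subseteq E$ with $|E_{k_1}|\le k_1$ and a set $E_{k_2}$ of pairs of non-adjacent vertices of $G$ with $|E_{k_2}|\le k_2$ such that the graph $(V,(E\cup E_{k_2})\setminus E_{k_1})$ belongs to $\mathcal{F}$ (i.e. $G$ is obtained from a graph of $\mathcal{F}$ by adding at most $k_1$ edges and deleting at most $k_2$ edges);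 such a set $E_{k_1}\cup E_{k_2}$ is called a modulator of $G$. *)

theory Defs
  imports Complex_Main "HOL-Library.Landau_Symbols"
begin

section \<open>Graphs, interval graphs and boxicity\<close>

type_synonym 'a graph = "'a set \<times> 'a set set"

abbreviation verts :: "'a graph \<Rightarrow> 'a set" where "verts G \<equiv> fst G"
abbreviation edges :: "'a graph \<Rightarrow> 'a set set" where "edges G \<equiv> snd G"

definition all_pairs :: "'a set \<Rightarrow> 'a set set" where
  "all_pairs V = {e. e \<subseteq> V \<and> card e = 2}"

definition simple_graph :: "'a graph \<Rightarrow> bool" where
  "simple_graph G \<longleftrightarrow> finite (verts G) \<and> edges G \<subseteq> all_pairs (verts G)"

definition complete_graph :: "'a graph \<Rightarrow> bool" where
  "complete_graph G \<longleftrightarrow> simple_graph G \<and> edges G = all_pairs (verts G)"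

definition interval_graph :: "'a graph \<Rightarrow> bool" where
  "interval_graph G \<longleftrightarrow> simple_graph G \<and>
     (\<exists>l r :: 'a \<Rightarrow> real. (\<forall>v\<in>verts G. l v \<le> r v) \<and>
        (\<forall>u\<in>verts G. \<forall>v\<in>verts G. u \<noteq> v \<longrightarrow>
           ({u, v} \<in> edges G \<longleftrightarrow> {l u..r u} \<inter> {l v..r v} \<noteq> {})))"

text \<open>
  The dimension of a representation is the length of the list; the same interval graph may occur
  several times.  Intersecting with the set of all pairs only matters for the empty list, which
  thus represents exactly the complete graphs.
\<close>

definition box_representation :: "'a graph \<Rightarrow> 'a graph list \<Rightarrow> bool" where
  "box_representation G B \<longleftrightarrow>
     (\<forall>I\<in>set B. interval_graph I \<and> verts I = verts G) \<and>
     edges G = all_pairs (verts G) \<inter> (\<Inter>I\<in>set B. edges I)"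

definition boxicity :: "'a graph \<Rightarrow> nat" where
  "boxicity G = (if complete_graph G then 0
     else LEAST k. \<exists>B. box_representation G B \<and> length B = k)"

section \<open>Modulators\<close>

definition is_modulator ::
  "'a graph set \<Rightarrow> nat \<Rightarrow> nat \<Rightarrow> 'a graph \<Rightarrow> 'a set set \<Rightarrow> bool" where
  "is_modulator F k1 k2 G M \<longleftrightarrow>
     (\<exists>E1 E2. M = E1 \<union> E2 \<and>
        E1 \<subseteq> edges G \<and> card E1 \<le> k1 \<and>
        E2 \<subseteq> all_pairs (verts G) - edges G \<and> card E2 \<le> k2 \<and>
        (verts G, (edges G \<union> E2) - E1) \<in> F)"

definition edit_family :: "'a graph set \<Rightarrow> nat \<Rightarrow> nat \<Rightarrow> 'a graph set" where
  "edit_family F k1 k2 = {G. simple_graph G \<and> (\<exists>M. is_modulator F k1 k2 G M)}"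

section \<open>Machine model\<close>

text \<open>
  A structured random access machine over the natural numbers, with finitely many scalar registers
  and one-dimensional arrays in each program.  Cost is uniform: every command, and every operator,
  constant and memory access in an evaluated expression, costs one step.  Subtraction is truncated,
  and multiplication is deliberately not available as a unit-cost operation.
\<close>

type_synonym name = nat

datatype aexp =
    Const nat
  | Reg name
  | Load name aexp
  | Plus aexp aexp
  | Minus aexp aexp

datatype bexp =
    Less aexp aexp
  | Equal aexp aexp
  | Neg bexp
  | Conj bexp bexp

datatype com =
    Skip
  | Assign name aexp
  | Store name aexp aexp
  | Seq com com
  | Cond bexp com com
  | While bexp com

type_synonym state = "(name \<Rightarrow> nat) \<times> (name \<Rightarrow> nat \<Rightarrow> nat)"

abbreviation regs :: "state \<Rightarrow> name \<Rightarrow> nat" where "regs s \<equiv> fst s"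
abbreviation arrays :: "state \<Rightarrow> name \<Rightarrow> nat \<Rightarrow> nat" where "arrays s \<equiv> snd s"

fun aval :: "aexp \<Rightarrow> state \<Rightarrow> nat" where
  "aval (Const c) s = c"
| "aval (Reg x) s = regs s x"
| "aval (Load a e) s = arrays s a (aval e s)"
| "aval (Plus e1 e2) s = aval e1 s + aval e2 s"
| "aval (Minus e1 e2) s = aval e1 s - aval e2 s"

fun acost :: "aexp \<Rightarrow> nat" where
  "acost (Const c) = 1"
| "acost (Reg x) = 1"
| "acost (Load a e) = 1 + acost e"
| "acost (Plus e1 e2) = 1 + acost e1 + acost e2"
| "acost (Minus e1 e2) = 1 + acost e1 + acost e2"

fun bval :: "bexp \<Rightarrow> state \<Rightarrow> bool" where
  "bval (Less e1 e2) s \<longleftrightarrow> aval e1 s < aval e2 s"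
| "bval (Equal e1 e2) s \<longleftrightarrow> aval e1 s = aval e2 s"
| "bval (Neg b) s \<longleftrightarrow> \<not> bval b s"
| "bval (Conj b1 b2) s \<longleftrightarrow> bval b1 s \<and> bval b2 s"

fun bcost :: "bexp \<Rightarrow> nat" where
  "bcost (Less e1 e2) = 1 + acost e1 + acost e2"
| "bcost (Equal e1 e2) = 1 + acost e1 + acost e2"
| "bcost (Neg b) = 1 + bcost b"
| "bcost (Conj b1 b2) = 1 + bcost b1 + bcost b2"

text \<open>\<open>exec c s t s'\<close>: started in \<open>s\<close>, the program \<open>c\<close> halts in \<open>s'\<close> after \<open>t\<close> steps.\<close>

inductive exec :: "com \<Rightarrow> state \<Rightarrow> nat \<Rightarrow> state \<Rightarrow> bool" where
  Skip: "exec Skip s 1 s"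
| Assign: "exec (Assign x e) s (1 + acost e) ((regs s)(x := aval e s), arrays s)"
| Store: "exec (Store a i e) s (1 + acost i + acost e)
     (regs s, (arrays s)(a := (arrays s a)(aval i s := aval e s)))"
| Seq: "exec c1 s t1 s1 \<Longrightarrow> exec c2 s1 t2 s2 \<Longrightarrow> exec (Seq c1 c2) s (t1 + t2) s2"
| CondTrue: "bval b s \<Longrightarrow> exec c1 s t s' \<Longrightarrow> exec (Cond b c1 c2) s (1 + bcost b + t) s'"
| CondFalse: "\<not> bval b s \<Longrightarrow> exec c2 s t s' \<Longrightarrow> exec (Cond b c1 c2) s (1 + bcost b + t) s'"
| WhileFalse: "\<not> bval b s \<Longrightarrow> exec (While b c) s (1 + bcost b) s"
| WhileTrue: "bval b s \<Longrightarrow> exec c s t1 s1 \<Longrightarrow> exec (While b c) s1 t2 s2 \<Longrightarrow>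
     exec (While b c) s (1 + bcost b + t1 + t2) s2"

inductive_cases exec_SkipE: "exec Skip s t s'"
inductive_cases exec_AssignE: "exec (Assign x e) s t s'"
inductive_cases exec_StoreE: "exec (Store a i e) s t s'"
inductive_cases exec_SeqE: "exec (Seq c1 c2) s t s'"
inductive_cases exec_CondE: "exec (Cond b c1 c2) s t s'"
inductive_cases exec_WhileE: "exec (While b c) s t s'"

lemma exec_deterministic:
  "exec c s t s' \<Longrightarrow> exec c s u s'' \<Longrightarrow> u = t \<and> s'' = s'"
proof (induction arbitrary: u s'' rule: exec.induct)
  case (Seq c1 s t1 s1 c2 t2 s2)
  from Seq.prems show ?case
  proof (rule exec_SeqE)
    fix t1' s1' t2'
    assume u: "u = t1' + t2'" and 1: "exec c1 s t1' s1'" and 2: "exec c2 s1' t2' s''"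
    from Seq.IH(1)[OF 1] have eq: "t1' = t1" "s1' = s1" by simp_all
    with Seq.IH(2) 2 have "t2' = t2 \<and> s'' = s2" by blast
    with u eq show ?thesis by simp
  qed
next
  case (WhileTrue b s c t1 s1 t2 s2)
  from WhileTrue.prems show ?case
  proof (rule exec_WhileE)
    fix t1' s1' t2'
    assume u: "u = Suc (bcost b + t1' + t2')"
      and 1: "exec c s t1' s1'" and 2: "exec (While b c) s1' t2' s''"
    from WhileTrue.IH(1)[OF 1] have eq: "t1' = t1" "s1' = s1" by simp_all
    with WhileTrue.IH(2) 2 have "t2' = t2 \<and> s'' = s2" by blast
    with u eq show ?thesis by simp
  qed (use WhileTrue.hyps in simp)
next
  case (CondTrue b s c1 t s' c2)
  from CondTrue.prems show ?case
    by (rule exec_CondE) (use CondTrue.hyps(1) in \<open>auto dest: CondTrue.IH\<close>)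
next
  case (CondFalse b s c2 t s' c1)
  from CondFalse.prems show ?case
    by (rule exec_CondE) (use CondFalse.hyps(1) in \<open>auto dest: CondFalse.IH\<close>)
next
  case (WhileFalse b s c)
  from WhileFalse.prems show ?case by (rule exec_WhileE) (use WhileFalse.hyps in auto)
qed (erule exec_SkipE exec_AssignE exec_StoreE; simp)+

section \<open>Input and output conventions\<close>

text \<open>
  A graph on the vertices \<open>0, \<dots>, n - 1\<close>: register 0 holds \<open>n\<close>, array 0 the adjacency matrix in
  row-major order, and all other memory is zero.
\<close>

definition graph_input :: "nat \<Rightarrow> nat set set \<Rightarrow> state" where
  "graph_input n E =
     ((\<lambda>_. 0)(0 := n),
      (\<lambda>_ _. 0)(0 := (\<lambda>i. if i < n * n \<and> {i div n, i mod n} \<in> E then 1 else 0)))"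

definition lists_pairs :: "(nat \<times> nat) list \<Rightarrow> nat set set \<Rightarrow> bool" where
  "lists_pairs ps M \<longleftrightarrow> distinct (map (\<lambda>(u, v). {u, v}) ps) \<and> (\<lambda>(u, v). {u, v}) ` set ps = M"

text \<open>
  A graph together with a list of vertex pairs: additionally, register 1 holds the length of the
  list, and arrays 1 and 2 the first and second components of its entries.
\<close>

definition graph_pairs_input :: "nat \<Rightarrow> nat set set \<Rightarrow> (nat \<times> nat) list \<Rightarrow> state" where
  "graph_pairs_input n E ps =
     ((regs (graph_input n E))(1 := length ps),
      (arrays (graph_input n E))
        (1 := (\<lambda>i. if i < length ps then fst (ps ! i) else 0),
         2 := (\<lambda>i. if i < length ps then snd (ps ! i) else 0)))"

definition intersection_graph :: "'a set \<Rightarrow> ('a \<Rightarrow> real) \<Rightarrow> ('a \<Rightarrow> real) \<Rightarrow> 'a graph" where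
  "intersection_graph V l r =
     (V, {{u, v} | u v. u \<in> V \<and> v \<in> V \<and> u \<noteq> v \<and> {l u..r u} \<inter> {l v..r v} \<noteq> {}})"

text \<open>
  Interval graphs are output by their interval assignments: register 0 holds the number of interval
  graphs, and entry \<open>j * n + v\<close> of array 0 and of array 1 the left and the right endpoint of the
  interval of vertex \<open>v\<close> in the \<open>j\<close>-th of them.
\<close>

definition outputs_interval_graphs :: "nat \<Rightarrow> state \<Rightarrow> nat graph list \<Rightarrow> bool" where
  "outputs_interval_graphs n s B \<longleftrightarrow>
     (\<forall>j<regs s 0. \<forall>v<n. arrays s 0 (j * n + v) \<le> arrays s 1 (j * n + v)) \<and>
     B = map (\<lambda>j. intersection_graph {..<n}
                (\<lambda>v. real (arrays s 0 (j * n + v)))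
                (\<lambda>v. real (arrays s 1 (j * n + v)))) [0..<regs s 0]"

text \<open>
  \<open>computes_box_reps A b F T\<close>: on every member of \<open>F\<close> with vertices \<open>0, \<dots>, n - 1\<close>, the program
  \<open>A\<close> computes a \<open>b\<close>-dimensional box representation within \<open>T n\<close> steps.
\<close>

definition computes_box_reps :: "com \<Rightarrow> nat \<Rightarrow> nat graph set \<Rightarrow> (nat \<Rightarrow> nat) \<Rightarrow> bool" where
  "computes_box_reps A b F T \<longleftrightarrow>
     (\<forall>n E. ({..<n}, E) \<in> F \<longrightarrow>
        (\<exists>t s B. exec A (graph_input n E) t s \<and> t \<le> T n \<and>
           outputs_interval_graphs n s B \<and>
           box_representation ({..<n}, E) B \<and> length B = b))"

end

theory Submission
  imports Defs "HOL-Real_Asymp.Real_Asymp"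
begin

text \<open>
  Let \<open>W\<close> be the set of endpoints of the modulator.  Outside of the pairs inside \<open>W\<close> the graph \<open>G\<close>
  agrees with the member \<open>G'\<close> of the family.  Each interval graph of a \<open>b\<close>-dimensional box
  representation of \<open>G'\<close> gives two interval supergraphs of \<open>G\<close>: stretch all intervals of \<open>W\<close> to the
  far left, or all of them to the far right.  Together they separate every non-adjacent pair that is
  not inside \<open>W\<close>.  The pairs inside \<open>W\<close> are handled by an optimal box representation of \<open>G[W]\<close>,
  extended by making all other vertices universal; its dimension is at most \<open>box(G)\<close>.  It is found by
  brute force: \<open>|W| \<le> m = 2 k\<close>, at most \<open>m\<close> interval graphs are needed, and endpoints can be taken
  below \<open>2 m\<close>, which leaves \<open>(2 m) ^ (2 m\<^sup>2)\<close> candidates.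
\<close>

section \<open>Reasoning about timed executions\<close>

text \<open>The program does not know \<open>box(G)\<close>, so optimality has to come from the
  order of the search. A candidate is a single number N, read in base \<open>2 * m\<close> with the
  first block in the lowest places. Candidates are tried in the order 0, 1, 2, ..., and a block of
  zeros describes a complete graph. The least good N therefore occupies at most min(m, box(G))
  blocks, and the zero blocks above it are dropped. The machine has no multiplication, so N is kept
  as an array of digits with carry, and products such as \<open>u * n\<close> are tabulated or
  accumulated by addition. The given program is known only through its behaviour on the exact memory
  of \<open>graph_input\<close>. Hence whatever must outlive it is stored under names that it does
  not mention, the modulator is erased from the input memory, and a simulation lemma transfers its
  run to the larger memory. Besides the 2b stretched graphs there are d further ones; writing them
  costs order d * n, which is split between the n^2 term and the exponential term.\<close>

fun written_regs :: "com \<Rightarrow> name set" where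
  "written_regs Skip = {}"
| "written_regs (Assign x e) = {x}"
| "written_regs (Store a i e) = {}"
| "written_regs (Seq c1 c2) = written_regs c1 \<union> written_regs c2"
| "written_regs (Cond b c1 c2) = written_regs c1 \<union> written_regs c2"
| "written_regs (While b c) = written_regs c"

fun written_arrays :: "com \<Rightarrow> name set" where
  "written_arrays Skip = {}"
| "written_arrays (Assign x e) = {}"
| "written_arrays (Store a i e) = {a}"
| "written_arrays (Seq c1 c2) = written_arrays c1 \<union> written_arrays c2"
| "written_arrays (Cond b c1 c2) = written_arrays c1 \<union> written_arrays c2"
| "written_arrays (While b c) = written_arrays c"

text \<open>The frame condition of a program. It treats an array as a whole: after one store nothing
  is known of the other entries, so loop invariants have to carry them.\<close>

definition unchanged :: "com \<Rightarrow> state \<Rightarrow> state \<Rightarrow> bool" where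
  "unchanged c s s' \<longleftrightarrow>
     (\<forall>x. x \<notin> written_regs c \<longrightarrow> regs s' x = regs s x) \<and>
     (\<forall>a. a \<notin> written_arrays c \<longrightarrow> arrays s' a = arrays s a)"

lemma exec_unchanged: "exec c s t s' \<Longrightarrow> unchanged c s s'"
  by (induction rule: exec.induct) (auto simp: unchanged_def)

text \<open>A total-correctness triple with a step bound. The start state is fixed rather than
  described by a precondition, so that \<open>Q\<close> can compare the final memory with
  it.\<close>

definition run :: "com \<Rightarrow> nat \<Rightarrow> state \<Rightarrow> (state \<Rightarrow> bool) \<Rightarrow> bool" where
  "run c T s Q \<longleftrightarrow> (\<exists>t s'. exec c s t s' \<and> t \<le> T \<and> Q s')"

lemma run_weaken:
  assumes "run c T s Q" "T \<le> T'" "\<And>s'. Q s' \<Longrightarrow> unchanged c s s' \<Longrightarrow> Q' s'"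
  shows "run c T' s Q'"
  using assms exec_unchanged unfolding run_def by (meson le_trans)

lemma run_Seq:
  assumes "run c1 T1 s Q1" "\<And>s'. Q1 s' \<Longrightarrow> unchanged c1 s s' \<Longrightarrow> run c2 T2 s' Q" "T1 + T2 \<le> T"
  shows "run (Seq c1 c2) T s Q"
proof -
  from assms(1) obtain t1 s1 where 1: "exec c1 s t1 s1" "t1 \<le> T1" "Q1 s1"
    unfolding run_def by blast
  from assms(2)[OF 1(3) exec_unchanged[OF 1(1)]] obtain t2 s2
    where 2: "exec c2 s1 t2 s2" "t2 \<le> T2" "Q s2" unfolding run_def by blast
  have "exec (Seq c1 c2) s (t1 + t2) s2" using 1 2 by (blast intro: exec.intros)
  moreover have "t1 + t2 \<le> T" using 1 2 assms(3) by linarith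
  ultimately show ?thesis using 2 unfolding run_def by blast
qed

text \<open>The index \<open>i\<close> is a ghost counter and \<open>N\<close> only an upper bound
  for it, so the loop may stop early at a point that the program does not know beforehand, as the
  brute-force search does.\<close>

lemma run_While:
  assumes step: "\<And>i s. I i s \<Longrightarrow> bval b s \<Longrightarrow> i < N \<and> run c T s (I (Suc i))"
    and init: "I 0 s"
  shows "run (While b c) (N * (1 + bcost b + T) + 1 + bcost b) s (\<lambda>s'. \<exists>i. I i s' \<and> \<not> bval b s')"
proof -
  have "i \<le> N \<Longrightarrow> I i s \<Longrightarrow>
    run (While b c) ((N - i) * (1 + bcost b + T) + 1 + bcost b) s (\<lambda>s'. \<exists>i. I i s' \<and> \<not> bval b s')"
    for i s
  proof (induction "N - i" arbitrary: i s)
    case 0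
    then have "\<not> bval b s" using step[of i s] by auto
    then have "exec (While b c) s (1 + bcost b) s" by (rule exec.intros)
    then show ?case using 0 \<open>\<not> bval b s\<close> unfolding run_def by fastforce
  next
    case (Suc k)
    show ?case
    proof (cases "bval b s")
      case False
      then have "exec (While b c) s (1 + bcost b) s" by (rule exec.intros)
      then show ?thesis using Suc.prems False unfolding run_def by fastforce
    next
      case True
      from step[OF Suc.prems(2) True] obtain t1 s1
        where 1: "i < N" "exec c s t1 s1" "t1 \<le> T" "I (Suc i) s1" unfolding run_def by blast
      have "k = N - Suc i" "Suc i \<le> N" using Suc.hyps 1 by auto
      from Suc.hyps(1)[OF this 1(4)] obtain t2 s2
        where 2: "exec (While b c) s1 t2 s2"
          "t2 \<le> (N - Suc i) * (1 + bcost b + T) + 1 + bcost b" "\<exists>i. I i s2 \<and> \<not> bval b s2"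
        unfolding run_def by blast
      have e: "exec (While b c) s (1 + bcost b + t1 + t2) s2"
        using True 1 2 by (blast intro: exec.intros)
      have "N - i = Suc (N - Suc i)" using 1 by simp
      then have "1 + bcost b + t1 + t2 \<le> (N - i) * (1 + bcost b + T) + 1 + bcost b"
        using 1 2 by simp
      then show ?thesis using e 2 unfolding run_def by blast
    qed
  qed
  from this[of 0 s] init show ?thesis by simp
qed

definition For :: "name \<Rightarrow> aexp \<Rightarrow> com \<Rightarrow> com" where
  "For x e c = Seq (Assign x (Const 0))
     (While (Less (Reg x) e) (Seq c (Assign x (Plus (Reg x) (Const 1)))))"

lemma written_For [simp]:
  "written_regs (For x e c) = insert x (written_regs c)"
  "written_arrays (For x e c) = written_arrays c"
  by (auto simp: For_def)

text \<open>The bound \<open>e\<close> is evaluated again in every round, hence the hypothesis that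
  it keeps the value \<open>N\<close>. Of the 8 extra steps per round, 4 are the guard and 4 the
  increment of \<open>x\<close>; the final 6 are the initial assignment and the failing
  guard.\<close>

lemma run_For:
  assumes init: "I 0 ((regs s0)(x := 0), arrays s0)"
    and bound: "\<And>s. unchanged (For x e c) s0 s \<Longrightarrow> aval e s = N"
    and cost: "acost e = 1"
    and x: "x \<notin> written_regs c"
    and step: "\<And>i s. i < N \<Longrightarrow> regs s x = i \<Longrightarrow> I i s \<Longrightarrow> unchanged (For x e c) s0 s \<Longrightarrow>
          run c T s (\<lambda>s'. I (Suc i) ((regs s')(x := Suc i), arrays s'))"
  shows "run (For x e c) (N * (T + 8) + 6) s0 (\<lambda>s'. I N s' \<and> regs s' x = N)"
proof -
  \<comment> \<open>\<open>i \<le> N\<close> turns the failing guard into \<open>i = N\<close>, and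
    the frame part supplies the value of \<open>e\<close> in every round.\<close>
  define J where "J i s \<longleftrightarrow> I i s \<and> regs s x = i \<and> i \<le> N \<and> unchanged (For x e c) s0 s" for i s
  define s1 where "s1 = ((regs s0)(x := 0), arrays s0)"
  have "run (While (Less (Reg x) e) (Seq c (Assign x (Plus (Reg x) (Const 1)))))
    (N * (1 + bcost (Less (Reg x) e) + (T + 4)) + 1 + bcost (Less (Reg x) e)) s1
    (\<lambda>s'. \<exists>i. J i s' \<and> \<not> bval (Less (Reg x) e) s')"
  proof (rule run_While)
    show "J 0 s1" using init by (simp add: J_def s1_def unchanged_def)
  next
    fix i s
    assume J: "J i s" and b: "bval (Less (Reg x) e) s"
    have iN: "i < N" using J b bound[of s] by (simp add: J_def)
    have "run c T s (\<lambda>s'. I (Suc i) ((regs s')(x := Suc i), arrays s'))"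
      using step[of i s] iN J by (simp add: J_def)
    then obtain t s' where e: "exec c s t s'" "t \<le> T" "I (Suc i) ((regs s')(x := Suc i), arrays s')"
      unfolding run_def by blast
    have u: "unchanged c s s'" using e exec_unchanged by blast
    have x': "regs s' x = i" using u x J by (simp add: J_def unchanged_def)
    have e2: "exec (Assign x (Plus (Reg x) (Const 1))) s' 4 ((regs s')(x := Suc i), arrays s')"
      using exec.Assign[of x "Plus (Reg x) (Const 1)" s'] x' by (simp add: numeral_eq_Suc)
    have J': "J (Suc i) ((regs s')(x := Suc i), arrays s')"
      using J u e(3) iN by (auto simp: J_def unchanged_def)
    have "exec (Seq c (Assign x (Plus (Reg x) (Const 1)))) s (t + 4) ((regs s')(x := Suc i), arrays s')"
      using e e2 by (blast intro: exec.intros)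
    then show "i < N \<and> run (Seq c (Assign x (Plus (Reg x) (Const 1)))) (T + 4) s (J (Suc i))"
      using iN J' e(2) unfolding run_def by fastforce
  qed
  moreover have "N * (1 + bcost (Less (Reg x) e) + (T + 4)) + 1 + bcost (Less (Reg x) e)
      = N * (T + 8) + 4" by (simp add: cost algebra_simps)
  ultimately have "run (While (Less (Reg x) e) (Seq c (Assign x (Plus (Reg x) (Const 1)))))
    (N * (T + 8) + 4) s1 (\<lambda>s'. \<exists>i. J i s' \<and> \<not> bval (Less (Reg x) e) s')" by argo
  then obtain t s' where
    e: "exec (While (Less (Reg x) e) (Seq c (Assign x (Plus (Reg x) (Const 1))))) s1 t s'"
    "t \<le> N * (T + 8) + 4" "\<exists>i. J i s' \<and> \<not> bval (Less (Reg x) e) s'"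
    unfolding run_def by blast
  then obtain i where i: "J i s'" "\<not> bval (Less (Reg x) e) s'" by blast
  then have "i = N" using bound[of s'] by (simp add: J_def)
  then have post: "I N s' \<and> regs s' x = N" using i by (simp add: J_def)
  have "exec (Assign x (Const 0)) s0 2 s1"
    using exec.Assign[of x "Const 0" s0] by (simp add: s1_def numeral_eq_Suc)
  then have "exec (For x e c) s0 (2 + t) s'" unfolding For_def using e by (blast intro: exec.intros)
  moreover have "2 + t \<le> N * (T + 8) + 6" using e by simp
  ultimately show ?thesis using post unfolding run_def by blast
qed

section \<open>Loop-free programs\<close>

fun loop_free :: "com \<Rightarrow> bool" where
  "loop_free (Seq c1 c2) \<longleftrightarrow> loop_free c1 \<and> loop_free c2"
| "loop_free (Cond b c1 c2) \<longleftrightarrow> loop_free c1 \<and> loop_free c2"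
| "loop_free (While b c) \<longleftrightarrow> False"
| "loop_free c \<longleftrightarrow> True"

text \<open>With the effect given as a function, the simplifier executes loop-free code
  symbolically. The clause for \<open>While\<close> is a placeholder that \<open>loop_free\<close>
  excludes.\<close>

fun result :: "com \<Rightarrow> state \<Rightarrow> state" where
  "result Skip s = s"
| "result (Assign x e) s = ((regs s)(x := aval e s), arrays s)"
| "result (Store a i e) s = (regs s, (arrays s)(a := (arrays s a)(aval i s := aval e s)))"
| "result (Seq c1 c2) s = result c2 (result c1 s)"
| "result (Cond b c1 c2) s = (if bval b s then result c1 s else result c2 s)"
| "result (While b c) s = s"

fun max_cost :: "com \<Rightarrow> nat" where
  "max_cost Skip = 1"
| "max_cost (Assign x e) = 1 + acost e"
| "max_cost (Store a i e) = 1 + acost i + acost e"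
| "max_cost (Seq c1 c2) = max_cost c1 + max_cost c2"
| "max_cost (Cond b c1 c2) = 1 + bcost b + max (max_cost c1) (max_cost c2)"
| "max_cost (While b c) = 0"

lemma exec_loop_free: "loop_free c \<Longrightarrow> \<exists>t. exec c s t (result c s) \<and> t \<le> max_cost c"
proof (induction c arbitrary: s)
  case (Seq c1 c2)
  then obtain t1 t2 where t: "exec c1 s t1 (result c1 s)" "t1 \<le> max_cost c1"
    "exec c2 (result c1 s) t2 (result c2 (result c1 s))" "t2 \<le> max_cost c2"
    by (meson loop_free.simps(1))
  from exec.Seq[OF t(1,3)] t(2,4) show ?case by (intro exI[of _ "t1 + t2"]) simp
next
  case (Cond b c1 c2)
  show ?case
  proof (cases "bval b s")
    case True
    obtain t where t: "exec c1 s t (result c1 s)" "t \<le> max_cost c1" using Cond by fastforce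
    from exec.CondTrue[OF True t(1), of c2] t(2) show ?thesis using True
      by (intro exI[of _ "1 + bcost b + t"]) simp
  next
    case False
    obtain t where t: "exec c2 s t (result c2 s)" "t \<le> max_cost c2" using Cond by fastforce
    from exec.CondFalse[OF False t(1), of c1] t(2) show ?thesis using False
      by (intro exI[of _ "1 + bcost b + t"]) simp
  qed
next
  case Skip
  show ?case using exec.Skip[of s] by (intro exI[of _ 1]) simp
next
  case (Assign x e)
  show ?case using exec.Assign[of x e s] by (intro exI[of _ "1 + acost e"]) simp
next
  case (Store a i e)
  show ?case using exec.Store[of a i e s] by (intro exI[of _ "1 + acost i + acost e"]) simp
qed simp

lemma run_loop_free:
  "loop_free c \<Longrightarrow> max_cost c \<le> T \<Longrightarrow> Q (result c s) \<Longrightarrow> run c T s Q"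
  using exec_loop_free[of c s] unfolding run_def by (meson le_trans)

notation Seq (infixr ";;" 60)

text \<open>Reduces a loop with a loop-free body to goals for the simplifier; the sixth is
  preservation of the invariant, the eighth the conclusion drawn from it on exit.\<close>

lemma run_For_loop_free:
  assumes "loop_free c" "x \<notin> written_regs c" "acost e = 1"
    and "\<And>s'. unchanged (For x e c) s s' \<Longrightarrow> aval e s' = N"
    and "I 0 ((regs s)(x := 0), arrays s)"
    and "\<And>i s'. i < N \<Longrightarrow> regs s' x = i \<Longrightarrow> I i s' \<Longrightarrow> unchanged (For x e c) s s' \<Longrightarrow>
      I (Suc i) ((regs (result c s'))(x := Suc i), arrays (result c s'))"
    and "N * (max_cost c + 8) + 6 \<le> T"
    and "\<And>s'. I N s' \<Longrightarrow> unchanged (For x e c) s s' \<Longrightarrow> Q s'"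
  shows "run (For x e c) T s Q"
proof (rule run_weaken)
  show "run (For x e c) (N * (max_cost c + 8) + 6) s (\<lambda>s'. I N s' \<and> regs s' x = N)"
    using assms by (intro run_For run_loop_free) auto
qed (use assms in auto)

lemma runE:
  assumes "run c T s Q"
  obtains t s' where "exec c s t s'" "t \<le> T" "Q s'" "unchanged c s s'"
  using assms exec_unchanged unfolding run_def by blast

section \<open>Insensitivity to names that a program does not mention\<close>

fun aexp_bound :: "aexp \<Rightarrow> nat" where
  "aexp_bound (Const c) = 0"
| "aexp_bound (Reg x) = Suc x"
| "aexp_bound (Load a e) = max (Suc a) (aexp_bound e)"
| "aexp_bound (Plus e1 e2) = max (aexp_bound e1) (aexp_bound e2)"
| "aexp_bound (Minus e1 e2) = max (aexp_bound e1) (aexp_bound e2)"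

fun bexp_bound :: "bexp \<Rightarrow> nat" where
  "bexp_bound (Less e1 e2) = max (aexp_bound e1) (aexp_bound e2)"
| "bexp_bound (Equal e1 e2) = max (aexp_bound e1) (aexp_bound e2)"
| "bexp_bound (Neg b) = bexp_bound b"
| "bexp_bound (Conj b1 b2) = max (bexp_bound b1) (bexp_bound b2)"

fun name_bound :: "com \<Rightarrow> nat" where
  "name_bound Skip = 0"
| "name_bound (Assign x e) = max (Suc x) (aexp_bound e)"
| "name_bound (Store a i e) = max (Suc a) (max (aexp_bound i) (aexp_bound e))"
| "name_bound (Seq c1 c2) = max (name_bound c1) (name_bound c2)"
| "name_bound (Cond b c1 c2) = max (bexp_bound b) (max (name_bound c1) (name_bound c2))"
| "name_bound (While b c) = max (bexp_bound b) (name_bound c)"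

definition agree_below :: "nat \<Rightarrow> state \<Rightarrow> state \<Rightarrow> bool" where
  "agree_below K s s' \<longleftrightarrow> (\<forall>x<K. regs s x = regs s' x \<and> arrays s x = arrays s' x)"

lemma aval_agree: "aexp_bound e \<le> K \<Longrightarrow> agree_below K s s' \<Longrightarrow> aval e s = aval e s'"
  by (induction e) (auto simp: agree_below_def)

lemma bval_agree: "bexp_bound b \<le> K \<Longrightarrow> agree_below K s s' \<Longrightarrow> bval b s = bval b s'"
  by (induction b) (auto simp: aval_agree)

text \<open>The given program is specified only for the exact memory \<open>graph_input\<close>.
  This simulation moves its run, with the same number of steps, to a memory that holds other data
  under the names from \<open>K\<close> on.\<close>

lemma exec_agree:
  "exec c s t s' \<Longrightarrow> name_bound c \<le> K \<Longrightarrow> agree_below K s u \<Longrightarrow>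
     \<exists>u'. exec c u t u' \<and> agree_below K s' u'"
proof (induction arbitrary: u rule: exec.induct)
  case (Assign x e s)
  then have "agree_below K ((regs s)(x := aval e s), arrays s) ((regs u)(x := aval e u), arrays u)"
    using aval_agree[of e K s u] by (auto simp: agree_below_def)
  then show ?case using exec.Assign by blast
next
  case (Store a i e s)
  then have "agree_below K (regs s, (arrays s)(a := (arrays s a)(aval i s := aval e s)))
      (regs u, (arrays u)(a := (arrays u a)(aval i u := aval e u)))"
    using aval_agree[of e K s u] aval_agree[of i K s u] by (auto simp: agree_below_def)
  then show ?case using exec.Store by blast
next
  case (Seq c1 s t1 s1 c2 t2 s2)
  then show ?case by (metis exec.Seq name_bound.simps(4) max.bounded_iff)
next
  case (CondTrue b s c1 t s' c2)
  then show ?case by (metis exec.CondTrue name_bound.simps(5) max.bounded_iff bval_agree)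
next
  case (CondFalse b s c1 t s' c2)
  then show ?case by (metis exec.CondFalse name_bound.simps(5) max.bounded_iff bval_agree)
next
  case (WhileFalse b s c)
  then show ?case by (metis exec.WhileFalse name_bound.simps(6) max.bounded_iff bval_agree)
next
  case (WhileTrue b s c t1 s1 t2 s2)
  then show ?case by (metis exec.WhileTrue name_bound.simps(6) max.bounded_iff bval_agree)
qed (blast intro: exec.intros)

lemma written_below:
  "name_bound c \<le> K \<Longrightarrow> x \<in> written_regs c \<Longrightarrow> x < K"
  "name_bound c \<le> K \<Longrightarrow> x \<in> written_arrays c \<Longrightarrow> x < K"
  by (induction c) auto

section \<open>Box representations with integer endpoints\<close>

text \<open>\<open>box_representation\<close> in the terms of the machine: endpoints that can be
  read off two arrays instead of a list of graphs.\<close>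

definition represents ::
  "nat \<Rightarrow> nat set set \<Rightarrow> nat \<Rightarrow> (nat \<Rightarrow> nat \<Rightarrow> nat) \<Rightarrow> (nat \<Rightarrow> nat \<Rightarrow> nat) \<Rightarrow> bool" where
  "represents n E D l r \<longleftrightarrow>
     (\<forall>j<D. \<forall>v<n. l j v \<le> r j v) \<and>
     (\<forall>u<n. \<forall>v<n. u \<noteq> v \<longrightarrow> ({u, v} \<in> E \<longleftrightarrow> (\<forall>j<D. l j u \<le> r j v \<and> l j v \<le> r j u)))"

lemma intervals_meet_iff:
  fixes a b c d :: "'a::linorder"
  assumes "a \<le> b" "c \<le> d"
  shows "{a..b} \<inter> {c..d} \<noteq> {} \<longleftrightarrow> a \<le> d \<and> c \<le> b"
  using assms by (auto simp: Int_atLeastAtMost)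

lemma all_pairs_eq: "all_pairs V = {{u, v} | u v. u \<in> V \<and> v \<in> V \<and> u \<noteq> v}"
  by (auto simp: all_pairs_def card_2_iff)

lemma interval_graph_intersection_graph:
  assumes "finite V" "\<And>v. v \<in> V \<Longrightarrow> l v \<le> r v"
  shows "interval_graph (intersection_graph V l r)"
  unfolding interval_graph_def
proof (intro conjI exI)
  show "simple_graph (intersection_graph V l r)"
    using assms(1) by (auto simp: simple_graph_def intersection_graph_def all_pairs_def)
  show "\<forall>v\<in>verts (intersection_graph V l r). l v \<le> r v"
    using assms(2) by (simp add: intersection_graph_def)
  show "\<forall>u\<in>verts (intersection_graph V l r). \<forall>v\<in>verts (intersection_graph V l r). u \<noteq> v \<longrightarrow>
      ({u, v} \<in> edges (intersection_graph V l r)) = ({l u..r u} \<inter> {l v..r v} \<noteq> {})"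
    by (auto simp: intersection_graph_def doubleton_eq_iff)
qed

lemma edge_intersection_graph_iff:
  assumes "u \<in> V" "v \<in> V" "u \<noteq> v" "l u \<le> r u" "l v \<le> r v"
  shows "{u, v} \<in> edges (intersection_graph V l r) \<longleftrightarrow> l u \<le> r v \<and> l v \<le> r u"
proof -
  have "{u, v} \<in> edges (intersection_graph V l r) \<longleftrightarrow> {l u..r u} \<inter> {l v..r v} \<noteq> {}"
    using assms(1-3) by (auto simp: intersection_graph_def doubleton_eq_iff)
  then show ?thesis using intervals_meet_iff[OF assms(4,5)] by simp
qed

lemma box_representation_iff_represents:
  assumes "simple_graph ({..<n}, E)" and le: "\<forall>j<D. \<forall>v<n. l j v \<le> r j v"
  shows "box_representation ({..<n}, E)
      (map (\<lambda>j. intersection_graph {..<n} (\<lambda>v. real (l j v)) (\<lambda>v. real (r j v))) [0..<D])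
    \<longleftrightarrow> represents n E D l r" (is "box_representation _ (map ?I _) \<longleftrightarrow> _")
proof -
  have I: "interval_graph (?I j)" if "j < D" for j
    using le that by (intro interval_graph_intersection_graph) auto
  have edge: "{u, v} \<in> edges (?I j) \<longleftrightarrow> l j u \<le> r j v \<and> l j v \<le> r j u"
    if "u < n" "v < n" "u \<noteq> v" "j < D" for u v j
    using that le by (subst edge_intersection_graph_iff) auto
  have "box_representation ({..<n}, E) (map ?I [0..<D])
    \<longleftrightarrow> E = all_pairs {..<n} \<inter> (\<Inter>j<D. edges (?I j))"
    using I by (auto simp: box_representation_def intersection_graph_def lessThan_atLeast0)
  also have "\<dots> \<longleftrightarrow> (\<forall>e\<in>all_pairs {..<n}. e \<in> E \<longleftrightarrow> (\<forall>j<D. e \<in> edges (?I j)))"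
    using assms(1) unfolding simple_graph_def by auto
  also have "\<dots> \<longleftrightarrow> (\<forall>u<n. \<forall>v<n. u \<noteq> v \<longrightarrow> ({u, v} \<in> E \<longleftrightarrow> (\<forall>j<D. {u, v} \<in> edges (?I j))))"
    unfolding all_pairs_eq by (simp only: lessThan_iff) blast
  also have "\<dots> \<longleftrightarrow> represents n E D l r"
    unfolding represents_def using le by (auto simp: edge)
  finally show ?thesis .
qed

lemma represents_imp_box_representation:
  assumes "simple_graph ({..<n}, E)" "represents n E D l r"
  shows "box_representation ({..<n}, E)
      (map (\<lambda>j. intersection_graph {..<n} (\<lambda>v. real (l j v)) (\<lambda>v. real (r j v))) [0..<D])"
proof -
  have "\<forall>j<D. \<forall>v<n. l j v \<le> r j v" using assms(2) by (simp add: represents_def)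
  then show ?thesis using box_representation_iff_represents assms by blast
qed

lemma all_less_add_iff: "(\<forall>j<a + c. P j) \<longleftrightarrow> (\<forall>j<a. P j) \<and> (\<forall>j<c. P (a + j))" for a c :: nat
  by (metis add_diff_inverse_nat nat_add_left_cancel_less trans_less_add1)

text \<open>
  A vertex outside \<open>W\<close> that misses a vertex of \<open>W\<close> in the \<open>j\<close>-th interval graph still misses it
  after stretching the intervals of \<open>W\<close> to the left, or after stretching them to the right.
\<close>

lemma represents_combine:
  assumes rep: "represents n E' b l r"
    and bound: "\<And>j v. j < b \<Longrightarrow> v < n \<Longrightarrow> r j v \<le> R"
    and E': "\<And>u v. u < n \<Longrightarrow> v < n \<Longrightarrow> u \<noteq> v \<Longrightarrow> \<not> (u \<in> W \<and> v \<in> W) \<Longrightarrow> {u, v} \<in> E' \<longleftrightarrow> {u, v} \<in> E"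
    and W: "\<And>u v. u \<in> W \<Longrightarrow> v \<in> W \<Longrightarrow> u \<noteq> v \<Longrightarrow>
      {u, v} \<in> E \<longleftrightarrow> (\<forall>j<d. lW j u \<le> rW j v \<and> lW j v \<le> rW j u)"
    and boundW: "\<And>j v. j < d \<Longrightarrow> v \<in> W \<Longrightarrow> lW j v \<le> rW j v \<and> rW j v \<le> S"
    and L1: "\<And>j v. j < b \<Longrightarrow> v < n \<Longrightarrow> L j v = (if v \<in> W then 0 else l j v)"
    and L2: "\<And>j v. j < b \<Longrightarrow> v < n \<Longrightarrow> L (b + j) v = l j v"
    and L3: "\<And>j v. j < d \<Longrightarrow> v < n \<Longrightarrow> L (b + b + j) v = (if v \<in> W then lW j v else 0)"
    and U1: "\<And>j v. j < b \<Longrightarrow> v < n \<Longrightarrow> U j v = r j v"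
    and U2: "\<And>j v. j < b \<Longrightarrow> v < n \<Longrightarrow> U (b + j) v = (if v \<in> W then R else r j v)"
    and U3: "\<And>j v. j < d \<Longrightarrow> v < n \<Longrightarrow> U (b + b + j) v = (if v \<in> W then rW j v else S)"
  shows "represents n E (b + b + d) L U"
  unfolding represents_def all_less_add_iff
proof (intro conjI allI impI)
  fix j v assume "j < b" "v < n"
  moreover from this have le: "l j v \<le> r j v" "r j v \<le> R"
    using rep bound by (auto simp: represents_def)
  ultimately show "L j v \<le> U j v" "L (b + j) v \<le> U (b + j) v"
    by (auto simp: L1 U1 L2 U2)
next
  fix j v assume "j < d" "v < n"
  then show "L (b + b + j) v \<le> U (b + b + j) v" using boundW by (simp add: L3 U3)
next
  fix u v assume uv: "u < n" "v < n" "u \<noteq> v"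
  let ?m = "\<lambda>j. L j u \<le> U j v \<and> L j v \<le> U j u"
  have le: "l j u \<le> r j u" "l j v \<le> r j v" "r j u \<le> R" "r j v \<le> R" if "j < b" for j
    using that rep bound uv by (auto simp: represents_def)
  have rep': "{u, v} \<in> E' \<longleftrightarrow> (\<forall>j<b. l j u \<le> r j v \<and> l j v \<le> r j u)"
    using rep uv by (auto simp: represents_def)
  show "{u, v} \<in> E \<longleftrightarrow> ((\<forall>j<b. ?m j) \<and> (\<forall>j<b. ?m (b + j))) \<and> (\<forall>j<d. ?m (b + b + j))"
  proof (cases "u \<in> W \<and> v \<in> W")
    case True
    \<comment> \<open>Stretched to the left all intervals of \<open>W\<close> share the point 0,
      stretched to the right they share \<open>R\<close>, so none of these graphs separates
      \<open>u\<close> from \<open>v\<close>.\<close>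
    have "?m j" "?m (b + j)" if "j < b" for j
      using that True uv le[OF that] by (auto simp: L1 U1 L2 U2)
    moreover have "{u, v} \<in> E \<longleftrightarrow> (\<forall>j<d. ?m (b + b + j))"
      using True uv by (simp add: W L3 U3)
    ultimately show ?thesis by blast
  next
    case False
    \<comment> \<open>The vertex outside \<open>W\<close> has the interval from 0 to
      \<open>S\<close>, which meets all others.\<close>
    have "?m (b + b + j)" if "j < d" for j
      using that False uv boundW[OF that] by (auto simp: L3 U3 intro: le_trans)
    \<comment> \<open>If just one of the two lies in \<open>W\<close>, each of the two stretched
      copies keeps one of the two inequalities and makes the other one trivial.\<close>
    moreover have "?m j \<and> ?m (b + j) \<longleftrightarrow> l j u \<le> r j v \<and> l j v \<le> r j u" if "j < b" for j
      using that False uv le[OF that] by (auto simp: L1 U1 L2 U2 intro: le_trans)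
    moreover have "{u, v} \<in> E' \<longleftrightarrow> {u, v} \<in> E" using E' uv False by blast
    ultimately show ?thesis using rep' by blast
  qed
qed

text \<open>Every endpoint is replaced by the number of strictly smaller endpoints. There are at
  most \<open>2 * m\<close> distinct endpoints, which is where the base of the digit strings comes
  from; equal endpoints keep equal ranks, so touching intervals still touch.\<close>

lemma compress_endpoints:
  fixes l r :: "nat \<Rightarrow> real"
  assumes "\<And>p. p < m \<Longrightarrow> l p \<le> r p"
  shows "\<exists>l' w'. (\<forall>p<m. l' p < 2 * m \<and> w' p < 2 * m) \<and>
    (\<forall>p<m. \<forall>q<m. l p \<le> r q \<longleftrightarrow> l' p \<le> l' q + (w' q :: nat))"
proof -
  define S where "S = l ` {..<m} \<union> r ` {..<m}"
  define rank where "rank z = card {y \<in> S. y < z}" for z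
  have fin: "finite S" by (simp add: S_def)
  have "card S \<le> card (l ` {..<m}) + card (r ` {..<m})" unfolding S_def by (rule card_Un_le)
  also have "\<dots> \<le> 2 * m" using card_image_le[of "{..<m}" l] card_image_le[of "{..<m}" r] by simp
  finally have card: "card S \<le> 2 * m" .
  have rank_less: "rank z < 2 * m" if "z \<in> S" for z
  proof -
    have "rank z < card S" unfolding rank_def using fin that by (intro psubset_card_mono) auto
    then show ?thesis using card by simp
  qed
  have rank_le: "x \<le> y \<longleftrightarrow> rank x \<le> rank y" if "x \<in> S" "y \<in> S" for x y
  proof
    assume "x \<le> y" then show "rank x \<le> rank y"
      unfolding rank_def using fin by (intro card_mono) auto
  next
    assume le: "rank x \<le> rank y"
    show "x \<le> y"
    proof (rule ccontr)
      assume "\<not> x \<le> y"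
      then have "y < x" by simp
      then have "{z \<in> S. z < y} \<subseteq> {z \<in> S. z < x}" "y \<in> {z \<in> S. z < x}" "y \<notin> {z \<in> S. z < y}"
        using that by auto
      then have "rank y < rank x"
        unfolding rank_def using fin by (intro psubset_card_mono psubsetI) auto
      then show False using le by simp
    qed
  qed
  have S: "l p \<in> S" "r p \<in> S" if "p < m" for p using that by (auto simp: S_def)
  \<comment> \<open>The truncated subtraction is exact because ranks are monotone.\<close>
  have "rank (l p) + (rank (r p) - rank (l p)) = rank (r p)" if "p < m" for p
    using rank_le[OF S[OF that]] assms[OF that] by simp
  then show ?thesis
    using S rank_less rank_le
    by (intro exI[of _ "\<lambda>p. rank (l p)"] exI[of _ "\<lambda>p. rank (r p) - rank (l p)"])
      (auto simp: less_imp_diff_less)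
qed

section \<open>Candidates as numbers in base B\<close>

definition digit :: "nat \<Rightarrow> nat \<Rightarrow> nat \<Rightarrow> nat" where
  "digit B N i = N div B ^ i mod B"

lemma digit_0 [simp]: "digit B 0 = (\<lambda>_. 0)"
  by (simp add: digit_def fun_eq_iff)

text \<open>Base 0 has to be covered: the base will be \<open>2 * m\<close>, and an empty modulator
  gives \<open>m = 0\<close>.\<close>

lemma digit_eq_0: "N < B ^ L \<Longrightarrow> L \<le> i \<Longrightarrow> digit B N i = 0"
proof (cases "B = 0")
  case False
  assume "N < B ^ L" "L \<le> i"
  moreover from this False have "B ^ L \<le> B ^ i" by (intro power_increasing) auto
  ultimately show ?thesis by (simp add: digit_def)
qed (auto simp: digit_def power_0_left)

lemma ex_number_with_digits:
  assumes "\<And>i. i < L \<Longrightarrow> c i < B"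
  shows "\<exists>N<B ^ L. \<forall>i<L. digit B N i = c i"
  using assms
proof (induction L)
  case (Suc L)
  then obtain N where N: "N < B ^ L" "\<And>i. i < L \<Longrightarrow> digit B N i = c i" by auto
  have c: "c L < B" using Suc by simp
  let ?N = "N + c L * B ^ L"
  have "?N < B ^ L + c L * B ^ L" using N by simp
  also have "\<dots> = Suc (c L) * B ^ L" by simp
  also have "\<dots> \<le> B * B ^ L" using c by (intro mult_right_mono) auto
  finally have "?N < B ^ Suc L" by simp
  moreover have "digit B ?N i = c i" if "i < Suc L" for i
  proof (cases "i = L")
    case True
    then show ?thesis using N(1) c by (simp add: digit_def div_mult_self2)
  next
    case False
    then have i: "i < L" using that by simp
    \<comment> \<open>Below position \<open>L\<close> the new leading digit only adds a multiple of
      \<open>B ^ Suc i\<close>, which the digit at \<open>i\<close> does not see.\<close>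
    have "B ^ L = B ^ i * (B * B ^ (L - Suc i))"
      using i by (metis Suc_diff_Suc add_diff_inverse_nat not_less_iff_gr_or_eq power_Suc power_add order.asym)
    then have "?N = N + B ^ i * (B * (c L * B ^ (L - Suc i)))" by (simp only: mult_ac)
    moreover have "B ^ i \<noteq> 0" using c by simp
    ultimately have "?N div B ^ i = B * (c L * B ^ (L - Suc i)) + N div B ^ i"
      by (metis div_mult_self2)
    then have "digit B ?N i = digit B N i" by (simp add: digit_def)
    then show ?thesis using N i by simp
  qed
  ultimately show ?case by blast
qed simp

text \<open>
  The digit string \<open>X\<close> consists of \<open>D\<close> blocks of length \<open>2 * m\<close>, each of them an interval assignment
  to the \<open>m\<close> listed vertices \<open>x 0, \<dots>, x (m - 1)\<close>: first the left endpoints, then the lengths.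
  Storing lengths makes every digit string an interval assignment, and vertices may be listed
  repeatedly.
\<close>

definition good_digits :: "nat \<Rightarrow> (nat \<Rightarrow> nat) \<Rightarrow> nat set set \<Rightarrow> nat \<Rightarrow> (nat \<Rightarrow> nat) \<Rightarrow> bool" where
  "good_digits m x E D X \<longleftrightarrow> (\<forall>p<m. \<forall>q<m. x p \<noteq> x q \<longrightarrow> ({x p, x q} \<in> E \<longleftrightarrow>
     (\<forall>j<D. X (j * (2 * m) + p) \<le> X (j * (2 * m) + q) + X (j * (2 * m) + m + q) \<and>
            X (j * (2 * m) + q) \<le> X (j * (2 * m) + p) + X (j * (2 * m) + m + p))))"

text \<open>A zero block gives the interval [0, 0] to every listed vertex. This is a complete graph,
  which adds no constraint.\<close>

lemma good_digits_zero_blocks: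
  assumes "d \<le> D" "\<And>i. d * (2 * m) \<le> i \<Longrightarrow> X i = 0"
  shows "good_digits m x E D X \<longleftrightarrow> good_digits m x E d X"
proof -
  have "X (j * (2 * m) + i) = 0" if "d \<le> j" for i j
    using assms(2) that by (meson mult_le_mono1 trans_le_add1)
  then have "X (j * (2 * m) + p) \<le> X (j * (2 * m) + q) + X (j * (2 * m) + m + q)" if "d \<le> j" for j p q
    using that by simp
  then have "(\<forall>j<D. X (j * (2 * m) + p) \<le> X (j * (2 * m) + q) + X (j * (2 * m) + m + q) \<and>
            X (j * (2 * m) + q) \<le> X (j * (2 * m) + p) + X (j * (2 * m) + m + p)) \<longleftrightarrow>
    (\<forall>j<d. X (j * (2 * m) + p) \<le> X (j * (2 * m) + q) + X (j * (2 * m) + m + q) \<and>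
            X (j * (2 * m) + q) \<le> X (j * (2 * m) + p) + X (j * (2 * m) + m + p))" for p q
    using assms(1) by (meson not_le order.strict_trans2)
  then show ?thesis unfolding good_digits_def by simp
qed

text \<open>Packs \<open>d\<close> separate assignments into one number. The exponent
  \<open>d * (2 * m)\<close> ties the number of blocks to the size of the number.\<close>

lemma ex_good_digits:
  assumes "\<And>j p. j < d \<Longrightarrow> p < m \<Longrightarrow> l j p < 2 * m \<and> w j p < 2 * m"
    and "\<And>p q. p < m \<Longrightarrow> q < m \<Longrightarrow> x p \<noteq> x q \<Longrightarrow>
      {x p, x q} \<in> E \<longleftrightarrow> (\<forall>j<d. l j p \<le> l j q + w j q \<and> l j q \<le> l j p + w j p)"
  shows "\<exists>N<(2 * m) ^ (d * (2 * m)). good_digits m x E d (digit (2 * m) N)"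
proof -
  define c where "c i = (if i mod (2 * m) < m then l (i div (2 * m)) (i mod (2 * m))
    else w (i div (2 * m)) (i mod (2 * m) - m))" for i
  have "c i < 2 * m" if "i < d * (2 * m)" for i
  proof -
    have "m > 0" using that by (cases m) auto
    then have "i div (2 * m) < d" "i mod (2 * m) < 2 * m"
      using that by (auto simp: less_mult_imp_div_less)
    then show ?thesis using assms(1) by (auto simp: c_def)
  qed
  then obtain N where N: "N < (2 * m) ^ (d * (2 * m))" "\<And>i. i < d * (2 * m) \<Longrightarrow> digit (2 * m) N i = c i"
    using ex_number_with_digits[of "d * (2 * m)" c "2 * m"] by auto
  have "digit (2 * m) N (j * (2 * m) + p) = l j p \<and> digit (2 * m) N (j * (2 * m) + m + p) = w j p"
    if "j < d" "p < m" for j p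
  proof -
    have "Suc j * (2 * m) \<le> d * (2 * m)" using that by (intro mult_le_mono1) simp
    then have "j * (2 * m) + p < d * (2 * m)" "j * (2 * m) + (m + p) < d * (2 * m)"
      using that by simp_all
    moreover have "c (j * (2 * m) + p) = l j p" "c (j * (2 * m) + (m + p)) = w j p"
      using that by (simp_all add: c_def)
    ultimately show ?thesis using N(2) by (simp add: add.assoc)
  qed
  then have "good_digits m x E d (digit (2 * m) N)"
    unfolding good_digits_def using assms(2) by simp
  then show ?thesis using N(1) by blast
qed

lemma ex_good_digits_length:
  "\<exists>N<(2 * m) ^ (m * (2 * m)). good_digits m x E m (digit (2 * m) N)"
proof -
  \<comment> \<open>The \<open>j\<close>-th graph separates \<open>x j\<close> at \<open>[0, 0]\<close> from its non-neighbours at \<open>[1, 1]\<close>; its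
    neighbours get \<open>[0, 1]\<close>.\<close>
  let ?l = "\<lambda>j p. if x p = x j \<or> {x p, x j} \<in> E then 0 else 1 :: nat"
  let ?w = "\<lambda>j p. if x p \<noteq> x j \<and> {x p, x j} \<in> E then 1 else 0 :: nat"
  show ?thesis
  proof (rule ex_good_digits[where l = ?l and w = ?w])
    show "?l j p < 2 * m \<and> ?w j p < 2 * m" if "j < m" "p < m" for j p using that by simp
    show "{x p, x q} \<in> E \<longleftrightarrow> (\<forall>j<m. ?l j p \<le> ?l j q + ?w j q \<and> ?l j q \<le> ?l j p + ?w j p)"
      if "p < m" "q < m" "x p \<noteq> x q" for p q
    proof
      assume "{x p, x q} \<in> E"
      then show "\<forall>j<m. ?l j p \<le> ?l j q + ?w j q \<and> ?l j q \<le> ?l j p + ?w j p"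
        by (auto simp: insert_commute)
    next
      assume "\<forall>j<m. ?l j p \<le> ?l j q + ?w j q \<and> ?l j q \<le> ?l j p + ?w j p"
      from this[rule_format, OF that(1)] that(3) show "{x p, x q} \<in> E"
        by (auto simp: insert_commute split: if_splits)
    qed
  qed
qed

text \<open>Listing every vertex once by \<open>id\<close> shows that the set under
  \<open>LEAST\<close> in \<open>boxicity\<close> is nonempty.\<close>

lemma ex_box_representation:
  fixes n :: nat
  assumes "simple_graph ({..<n}, E)"
  shows "\<exists>B. box_representation ({..<n}, E) B"
proof -
  obtain N where "good_digits n id E n (digit (2 * n) N)" using ex_good_digits_length by blast
  then have "represents n E n (\<lambda>j v. digit (2 * n) N (j * (2 * n) + v))
    (\<lambda>j v. digit (2 * n) N (j * (2 * n) + v) + digit (2 * n) N (j * (2 * n) + n + v))"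
    by (simp add: good_digits_def represents_def)
  from represents_imp_box_representation[OF assms this] show ?thesis by blast
qed

text \<open>Here the bound of the boxicity of \<open>G[W]\<close> by that of \<open>G\<close>
  enters: each interval graph of \<open>B\<close> is restricted to the listed vertices, and its
  endpoints there are compressed.\<close>

lemma ex_good_digits_box_representation:
  assumes "box_representation (V, E) B" and x: "\<And>p. p < m \<Longrightarrow> x p \<in> V"
  shows "\<exists>N<(2 * m) ^ (length B * (2 * m)). good_digits m x E (length B) (digit (2 * m) N)"
proof -
  let ?D = "length B"
  have ex: "\<exists>l' w'. (\<forall>p<m. l' p < 2 * m \<and> w' p < 2 * m) \<and>
    (\<forall>p<m. \<forall>q<m. x p \<noteq> x q \<longrightarrow>
      ({x p, x q} \<in> edges (B ! j) \<longleftrightarrow> l' p \<le> l' q + w' q \<and> l' q \<le> l' p + (w' p :: nat)))"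
    if "j < ?D" for j
  proof -
    have "interval_graph (B ! j)" "verts (B ! j) = V"
      using assms(1) that by (auto simp: box_representation_def)
    then obtain l r :: "_ \<Rightarrow> real" where lr: "\<And>v. v \<in> V \<Longrightarrow> l v \<le> r v"
      "\<And>u v. u \<in> V \<Longrightarrow> v \<in> V \<Longrightarrow> u \<noteq> v \<Longrightarrow> {u, v} \<in> edges (B ! j) \<longleftrightarrow> {l u..r u} \<inter> {l v..r v} \<noteq> {}"
      unfolding interval_graph_def by metis
    obtain l' w' where lw: "\<forall>p<m. l' p < 2 * m \<and> w' p < 2 * m"
      "\<forall>p<m. \<forall>q<m. l (x p) \<le> r (x q) \<longleftrightarrow> l' p \<le> l' q + (w' q :: nat)"
      using compress_endpoints[of m "\<lambda>p. l (x p)" "\<lambda>p. r (x p)"] lr(1) x by auto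
    have "{x p, x q} \<in> edges (B ! j) \<longleftrightarrow> l (x p) \<le> r (x q) \<and> l (x q) \<le> r (x p)"
      if "p < m" "q < m" "x p \<noteq> x q" for p q
      using lr(2)[of "x p" "x q"] intervals_meet_iff[of "l (x p)" "r (x p)" "l (x q)" "r (x q)"]
        that lr(1) x by simp
    then show ?thesis using lw by blast
  qed
  then obtain l' w' where lw: "\<And>j p. j < ?D \<Longrightarrow> p < m \<Longrightarrow> l' j p < 2 * m \<and> w' j p < 2 * m"
    "\<And>j p q. j < ?D \<Longrightarrow> p < m \<Longrightarrow> q < m \<Longrightarrow> x p \<noteq> x q \<Longrightarrow>
      {x p, x q} \<in> edges (B ! j) \<longleftrightarrow> l' j p \<le> l' j q + w' j q \<and> l' j q \<le> l' j p + (w' j p :: nat)"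
    by metis
  show ?thesis
  proof (rule ex_good_digits)
    show "l' j p < 2 * m \<and> w' j p < 2 * m" if "j < ?D" "p < m" for j p using lw that by blast
    fix p q assume pq: "p < m" "q < m" "x p \<noteq> x q"
    \<comment> \<open>For an empty \<open>B\<close> the set of all pairs is all that is left of the
      intersection, so the pair must be known to lie in it.\<close>
    have "{x p, x q} \<in> all_pairs V" using x pq by (simp add: all_pairs_def)
    then have "{x p, x q} \<in> E \<longleftrightarrow> (\<forall>I\<in>set B. {x p, x q} \<in> edges I)"
      using assms(1) by (auto simp: box_representation_def)
    then have "{x p, x q} \<in> E \<longleftrightarrow> (\<forall>j<?D. {x p, x q} \<in> edges (B ! j))"
      by (simp only: all_set_conv_all_nth)
    then show "{x p, x q} \<in> E \<longleftrightarrow> (\<forall>j<?D. l' j p \<le> l' j q + w' j q \<and> l' j q \<le> l' j p + w' j p)"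
      using lw(2) pq by blast
  qed
qed

lemma box_representation_boxicity:
  assumes "box_representation G B"
  shows "\<exists>B'. box_representation G B' \<and> length B' = boxicity G"
proof (cases "complete_graph G")
  case True
  then have "box_representation G []" by (simp add: box_representation_def complete_graph_def)
  then show ?thesis using True by (auto simp: boxicity_def)
next
  case False
  let ?P = "\<lambda>k. \<exists>B'. box_representation G B' \<and> length B' = k"
  have "?P (length B)" using assms by blast
  then have "?P (Least ?P)" by (rule LeastI)
  then show ?thesis using False by (simp add: boxicity_def)
qed

text \<open>
  A digit string using only the first \<open>d\<close> blocks is a number below \<open>(2 * m) ^ (d * (2 * m))\<close>, so the
  least good number uses the least number of blocks.
\<close>

lemma least_good_digits_zero:
  assumes rep: "box_representation (V, E) B" and x: "\<And>p. p < m \<Longrightarrow> x p \<in> V"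
    and least: "\<And>N'. N' < N \<Longrightarrow> \<not> good_digits m x E m (digit (2 * m) N')"
  shows "\<exists>d\<le>m. d \<le> boxicity (V, E) \<and> (\<forall>i\<ge>d * (2 * m). digit (2 * m) N i = 0)"
proof -
  obtain B' where B': "box_representation (V, E) B'" "length B' = boxicity (V, E)"
    using box_representation_boxicity[OF rep] by blast
  \<comment> \<open>\<open>d\<close> is the smaller one of \<open>m\<close> and the boxicity; if
    that is \<open>m\<close>, the general construction with \<open>m\<close> blocks is used.\<close>
  have "\<exists>d\<le>m. d \<le> boxicity (V, E) \<and>
    (\<exists>N0<(2 * m) ^ (d * (2 * m)). good_digits m x E d (digit (2 * m) N0))"
  proof (cases "boxicity (V, E) \<le> m")
    case True
    then show ?thesis using ex_good_digits_box_representation[OF B'(1) x] B'(2) by auto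
  next
    case False
    then show ?thesis using ex_good_digits_length[of m x E] by (intro exI[of _ m]) auto
  qed
  then obtain d N0 where d: "d \<le> m" "d \<le> boxicity (V, E)" "N0 < (2 * m) ^ (d * (2 * m))"
    "good_digits m x E d (digit (2 * m) N0)" by blast
  \<comment> \<open>Padding with zero blocks makes \<open>N0\<close> a competitor of
    \<open>N\<close> in the search over \<open>m\<close> blocks.\<close>
  have "good_digits m x E m (digit (2 * m) N0)"
    using good_digits_zero_blocks[of d m m "digit (2 * m) N0" x E] d digit_eq_0 by blast
  then have "N \<le> N0" using least not_le by blast
  then have "N < (2 * m) ^ (d * (2 * m))" using d by simp
  then show ?thesis using d digit_eq_0 by blast
qed

section \<open>Adding one in base B\<close>

lemma digit_Suc:
  "digit B (Suc N) i = (if Suc N mod B ^ i = 0 then if Suc (digit B N i) = B then 0 else Suc (digit B N i)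
     else digit B N i)"
  by (simp add: digit_def div_Suc mod_Suc)

text \<open>A carry reaches position \<open>i\<close> when one is added to \<open>N\<close> exactly
  if \<open>B ^ i\<close> divides \<open>Suc N\<close>. Applied to \<open>Suc N\<close>, this
  equivalence passes that condition to the next position by looking at the digit just
  written.\<close>

lemma mod_power_Suc_eq_0_iff:
  fixes B N :: nat
  assumes "B > 0"
  shows "N mod B ^ Suc i = 0 \<longleftrightarrow> N mod B ^ i = 0 \<and> digit B N i = 0"
proof -
  have "N mod (B ^ i * B) = B ^ i * (N div B ^ i mod B) + N mod B ^ i" by (rule mod_mult2_eq)
  then show ?thesis using assms by (auto simp: digit_def mult.commute)
qed

section \<open>Preparing the input of the given program\<close>

text \<open>Zero outside the matrix, so that the whole array can be compared with array 0 of
  \<open>graph_input\<close>.\<close>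

definition adjacency :: "nat \<Rightarrow> nat set set \<Rightarrow> nat \<Rightarrow> nat" where
  "adjacency n E = (\<lambda>i. if i < n * n \<and> {i div n, i mod n} \<in> E then 1 else 0)"

lemma index_less: "u < n \<Longrightarrow> v < n \<Longrightarrow> u * n + v < n * n" for u v n :: nat
proof -
  assume "u < n" "v < n"
  then have "Suc u * n \<le> n * n" by (intro mult_le_mono1) simp
  then show ?thesis using \<open>v < n\<close> by simp
qed

lemma adjacency_index: "u < n \<Longrightarrow> v < n \<Longrightarrow> adjacency n E (u * n + v) = (if {u, v} \<in> E then 1 else 0)"
  by (auto simp: adjacency_def index_less)

text \<open>The pairs of \<open>E1\<close> are edges and those of \<open>E2\<close> are not, so
  passing to the member of the family is a symmetric difference; the program need not be told which
  pairs are of which kind.\<close>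

definition toggle :: "'a set \<Rightarrow> 'a set \<Rightarrow> 'a set" where
  "toggle E M = (E - M) \<union> (M - E)"

lemma adjacency_toggle_insert:
  assumes "u < n" "v < n" "u \<noteq> v" "{u, v} \<notin> M"
  shows "adjacency n (toggle E (insert {u, v} M)) =
    (let f = adjacency n (toggle E M); g = f(u * n + v := 1 - f (u * n + v))
     in g(v * n + u := 1 - g (v * n + u)))"
proof
  fix i
  \<comment> \<open>With equal indices the second flip would undo the first.\<close>
  have ne: "u * n + v \<noteq> v * n + u"
  proof
    assume "u * n + v = v * n + u"
    then have "(u * n + v) div n = (v * n + u) div n" by simp
    then show False using assms by simp
  qed
  have cases: "i = u * n + v \<or> i = v * n + u" if "{i div n, i mod n} = {u, v}"
    using that div_mult_mod_eq[of i n] by (auto simp: doubleton_eq_iff)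
  show "adjacency n (toggle E (insert {u, v} M)) i =
    (let f = adjacency n (toggle E M); g = f(u * n + v := 1 - f (u * n + v))
     in g(v * n + u := 1 - g (v * n + u))) i"
  proof (cases "i = u * n + v \<or> i = v * n + u")
    case True
    then show ?thesis using assms ne
      by (auto simp: Let_def adjacency_index toggle_def insert_commute)
  next
    case False
    then show ?thesis using cases by (auto simp: Let_def adjacency_def toggle_def)
  qed
qed

text \<open>
  The given program uses names below \<open>K\<close> only, so its execution does not interfere with the registers
  (\<open>r\<dots>\<close>) and arrays (\<open>a\<dots>\<close>) below.  The offsets start at 3 so that they also differ from the names
  0, 1 and 2 of the input.
\<close>

locale fresh_names =
  fixes K :: nat
begin

abbreviation "rn \<equiv> K + 3"
abbreviation "rlen \<equiv> K + 4"
abbreviation "rm \<equiv> K + 5"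
abbreviation "ri \<equiv> K + 6"
abbreviation "rj \<equiv> K + 7"
abbreviation "rp \<equiv> K + 8"
abbreviation "rq \<equiv> K + 9"
abbreviation "ridx \<equiv> K + 10"
abbreviation "rfound \<equiv> K + 11"
abbreviation "rall \<equiv> K + 12"
abbreviation "rcarry \<equiv> K + 13"
abbreviation "rB \<equiv> K + 14"
abbreviation "rL \<equiv> K + 15"
abbreviation "rd \<equiv> K + 16"
abbreviation "rbn \<equiv> K + 17"
abbreviation "rR \<equiv> K + 18"
abbreviation "rv \<equiv> K + 19"
abbreviation "ru \<equiv> K + 20"

abbreviation "aX \<equiv> K + 3"
abbreviation "ax \<equiv> K + 4"
abbreviation "apos \<equiv> K + 5"
abbreviation "aadj \<equiv> K + 6"
abbreviation "arow \<equiv> K + 7"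

text \<open>The row offsets are tabulated since the machine has no multiplication. The accumulator
  ends at \<open>n * n\<close>, the length of the loop that copies the matrix.\<close>

definition "compute_rows = For ri (Reg rn)
  (Store arow (Reg ri) (Reg ridx) ;; Assign ridx (Plus (Reg ridx) (Reg rn)))"

lemma run_compute_rows:
  assumes "regs s rn = n" "regs s ridx = 0"
  shows "run compute_rows (n * 15 + 6) s (\<lambda>s'. (\<forall>k<n. arrays s' arow k = k * n) \<and> regs s' ridx = n * n)"
  unfolding compute_rows_def
  by (rule run_For_loop_free[where N = n and
        I = "\<lambda>i s'. (\<forall>k<i. arrays s' arow k = k * n) \<and> regs s' ridx = i * n"])
    (use assms in \<open>auto simp: unchanged_def less_Suc_eq\<close>)

text \<open>The search needs the adjacency of \<open>G\<close>, while array 0 is about to be turned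
  into the input of the given program.\<close>

definition "copy_adjacency = For ri (Reg ridx) (Store aadj (Reg ri) (Load 0 (Reg ri)))"

lemma run_copy_adjacency:
  assumes "regs s ridx = N"
  shows "run copy_adjacency (N * 12 + 6) s (\<lambda>s'. \<forall>k<N. arrays s' aadj k = arrays s 0 k)"
  unfolding copy_adjacency_def
  by (rule run_For_loop_free[where N = N and I = "\<lambda>i s'. \<forall>k<i. arrays s' aadj k = arrays s 0 k"])
    (use assms in \<open>auto simp: unchanged_def less_Suc_eq\<close>)

text \<open>First and second components are joined into one list of vertices. Arrays 1 and 2 are
  erased because \<open>graph_input\<close> has zeros there.\<close>

definition "list_vertices = For ri (Reg rlen)
  (Store ax (Reg ri) (Load 1 (Reg ri)) ;; Store ax (Plus (Reg rlen) (Reg ri)) (Load 2 (Reg ri)) ;;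
   Store 1 (Reg ri) (Const 0) ;; Store 2 (Reg ri) (Const 0))"

lemma run_list_vertices:
  assumes "regs s rlen = len"
  shows "run list_vertices (len * 30 + 6) s (\<lambda>s'.
    (\<forall>k<len. arrays s' ax k = arrays s 1 k \<and> arrays s' ax (len + k) = arrays s 2 k) \<and>
    arrays s' 1 = (\<lambda>k. if k < len then 0 else arrays s 1 k) \<and>
    arrays s' 2 = (\<lambda>k. if k < len then 0 else arrays s 2 k))"
  unfolding list_vertices_def
  by (rule run_For_loop_free[where N = len and I = "\<lambda>i s'.
    (\<forall>k<i. arrays s' ax k = arrays s 1 k \<and> arrays s' ax (len + k) = arrays s 2 k) \<and>
    arrays s' 1 = (\<lambda>k. if k < i then 0 else arrays s 1 k) \<and>
    arrays s' 2 = (\<lambda>k. if k < i then 0 else arrays s 2 k)"])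
    (use assms in \<open>auto simp: unchanged_def less_Suc_eq fun_eq_iff\<close>)

definition "compute_positions = For rp (Reg rm) (Store apos (Load ax (Reg rp)) (Plus (Reg rp) (Const 1)))"

text \<open>Positions are shifted by one, so that the initial 0 of the memory means that a vertex is
  not listed. For a vertex listed several times any of its positions may be stored.\<close>

definition position_of :: "nat \<Rightarrow> (nat \<Rightarrow> nat) \<Rightarrow> (nat \<Rightarrow> nat) \<Rightarrow> bool" where
  "position_of m x pos \<longleftrightarrow> (\<forall>w. (pos w = 0 \<longleftrightarrow> w \<notin> x ` {..<m}) \<and>
     (pos w \<noteq> 0 \<longrightarrow> pos w \<le> m \<and> x (pos w - 1) = w))"

lemma run_compute_positions:
  assumes "regs s rm = m" "arrays s apos = (\<lambda>_. 0)" "\<And>p. p < m \<Longrightarrow> arrays s ax p = x p"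
  shows "run compute_positions (m * 14 + 6) s (\<lambda>s'. position_of m x (arrays s' apos))"
  unfolding compute_positions_def
  by (rule run_For_loop_free[where N = m and I = "\<lambda>i s'. position_of i x (arrays s' apos)"])
    (use assms in \<open>auto simp: unchanged_def position_of_def lessThan_Suc intro: le_SucI\<close>)

definition "toggle_adjacency = For ri (Reg rlen)
  (Assign ru (Load ax (Reg ri)) ;; Assign rv (Load ax (Plus (Reg rlen) (Reg ri))) ;;
   Assign ridx (Plus (Load arow (Reg ru)) (Reg rv)) ;;
   Store 0 (Reg ridx) (Minus (Const 1) (Load 0 (Reg ridx))) ;;
   Assign ridx (Plus (Load arow (Reg rv)) (Reg ru)) ;;
   Store 0 (Reg ridx) (Minus (Const 1) (Load 0 (Reg ridx))))"

lemma run_toggle_adjacency: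
  assumes "regs s rlen = length ps" "arrays s 0 = adjacency n E"
    and "\<And>k. k < n \<Longrightarrow> arrays s arow k = k * n"
    and "\<And>k. k < length ps \<Longrightarrow> arrays s ax k = fst (ps ! k) \<and> arrays s ax (length ps + k) = snd (ps ! k)"
    and ps: "distinct (map (\<lambda>(u, v). {u, v}) ps)" "\<And>u v. (u, v) \<in> set ps \<Longrightarrow> u < n \<and> v < n \<and> u \<noteq> v"
  shows "run toggle_adjacency (length ps * 50 + 6) s
    (\<lambda>s'. arrays s' 0 = adjacency n (toggle E ((\<lambda>(u, v). {u, v}) ` set ps)))"
  unfolding toggle_adjacency_def
proof (rule run_For_loop_free[where N = "length ps" and
        I = "\<lambda>i s'. arrays s' 0 = adjacency n (toggle E (set (take i (map (\<lambda>(u, v). {u, v}) ps))))"], goal_cases)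
  case (6 i s')
  obtain u v where uv: "ps ! i = (u, v)" by fastforce
  then have uvn: "u < n" "v < n" "u \<noteq> v" using ps(2)[of u v] 6(1) nth_mem[of i ps] by auto
  let ?M = "set (take i (map (\<lambda>(u, v). {u, v}) ps))"
  have take: "take (Suc i) (map (\<lambda>(u, v). {u, v}) ps) = take i (map (\<lambda>(u, v). {u, v}) ps) @ [{u, v}]"
    using 6(1) uv by (simp add: take_Suc_conv_app_nth)
  have "distinct (take (Suc i) (map (\<lambda>(u, v). {u, v}) ps))" using ps(1) distinct_take by blast
  \<comment> \<open>A pair listed twice would be flipped back; \<open>distinct\<close> rules this
    out.\<close>
  then have "{u, v} \<notin> ?M" unfolding take by simp
  from adjacency_toggle_insert[OF uvn this, of E] show ?case
    using 6 assms uv uvn unfolding take by (simp add: unchanged_def Let_def)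
qed (use assms in \<open>auto simp: unchanged_def toggle_def\<close>)

definition "setup =
  Assign rn (Reg 0) ;; Assign rlen (Reg 1) ;; Assign 1 (Const 0) ;; Assign rm (Plus (Reg rlen) (Reg rlen)) ;;
  Assign ridx (Const 0)"

definition "prepare = setup ;; compute_rows ;; copy_adjacency ;; list_vertices ;; compute_positions ;;
  toggle_adjacency"

definition listed_vertex :: "(nat \<times> nat) list \<Rightarrow> nat \<Rightarrow> nat" where
  "listed_vertex ps p = (if p < length ps then fst (ps ! p) else snd (ps ! (p - length ps)))"

text \<open>What the later phases rely on. It mentions names above \<open>K\<close> only, and so it
  survives the run of the given program.\<close>

definition prepared :: "nat \<Rightarrow> nat set set \<Rightarrow> nat \<Rightarrow> (nat \<Rightarrow> nat) \<Rightarrow> state \<Rightarrow> bool" where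
  "prepared n E m x s \<longleftrightarrow> regs s rn = n \<and> regs s rm = m \<and>
     (\<forall>p<m. arrays s ax p = x p) \<and> position_of m x (arrays s apos) \<and>
     (\<forall>k<n * n. arrays s aadj k = adjacency n E k) \<and> (\<forall>k<n. arrays s arow k = k * n)"

lemma run_prepare:
  assumes ps: "distinct (map (\<lambda>(u, v). {u, v}) ps)" "\<And>u v. (u, v) \<in> set ps \<Longrightarrow> u < n \<and> v < n \<and> u \<noteq> v"
  shows "run prepare (120 * (n * n + n + length ps + 1)) (graph_pairs_input n E ps) (\<lambda>s.
    agree_below K s (graph_input n (toggle E ((\<lambda>(u, v). {u, v}) ` set ps))) \<and>
    prepared n E (2 * length ps) (listed_vertex ps) s \<and> arrays s aX = (\<lambda>_. 0))"
proof -
  let ?len = "length ps"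
  let ?s = "graph_pairs_input n E ps"
  define s1 where "s1 = result setup ?s"
  have s1: "regs s1 rn = n" "regs s1 rlen = ?len" "regs s1 rm = 2 * ?len" "regs s1 ridx = 0"
     "regs s1 0 = n" "regs s1 1 = 0" "\<And>x. x < K \<Longrightarrow> x \<noteq> 0 \<Longrightarrow> regs s1 x = 0"
     "arrays s1 0 = adjacency n E"
     "arrays s1 1 = (\<lambda>k. if k < ?len then fst (ps ! k) else 0)"
     "arrays s1 2 = (\<lambda>k. if k < ?len then snd (ps ! k) else 0)"
     "\<And>a. a > 2 \<Longrightarrow> arrays s1 a = (\<lambda>_. 0)"
    by (auto simp: s1_def setup_def graph_pairs_input_def graph_input_def adjacency_def)
  have "run setup 16 ?s (\<lambda>s'. s' = s1)"
    by (rule run_loop_free) (auto simp: s1_def setup_def)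
  then obtain t1 where e1: "exec setup ?s t1 s1" "t1 \<le> 16" by (auto elim: runE)
  obtain t2 s2 where e2: "exec compute_rows s1 t2 s2" "t2 \<le> n * 15 + 6"
    and q2: "(\<forall>k<n. arrays s2 arow k = k * n) \<and> regs s2 ridx = n * n"
    and u2: "unchanged compute_rows s1 s2"
    using run_compute_rows[OF s1(1,4)] by (rule runE)
  note u2 = u2[unfolded unchanged_def compute_rows_def, simplified]
  obtain t3 s3 where e3: "exec copy_adjacency s2 t3 s3" "t3 \<le> n * n * 12 + 6"
    and q3: "\<forall>k<n * n. arrays s3 aadj k = arrays s2 0 k"
    and u3: "unchanged copy_adjacency s2 s3"
    using run_copy_adjacency[OF conjunct2[OF q2]] by (rule runE)
  note u3 = u3[unfolded unchanged_def copy_adjacency_def, simplified]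
  have len: "regs s3 rlen = ?len" using s1 u2 u3 by simp
  obtain t4 s4 where e4: "exec list_vertices s3 t4 s4" "t4 \<le> ?len * 30 + 6"
    and q4: "(\<forall>k<?len. arrays s4 ax k = arrays s3 1 k \<and> arrays s4 ax (?len + k) = arrays s3 2 k) \<and>
      arrays s4 1 = (\<lambda>k. if k < ?len then 0 else arrays s3 1 k) \<and>
      arrays s4 2 = (\<lambda>k. if k < ?len then 0 else arrays s3 2 k)"
    and u4: "unchanged list_vertices s3 s4"
    using run_list_vertices[OF len] by (rule runE)
  note u4 = u4[unfolded unchanged_def list_vertices_def, simplified]
  have ax: "arrays s4 ax k = fst (ps ! k) \<and> arrays s4 ax (?len + k) = snd (ps ! k)" if "k < ?len" for k
    using that q4 u3 u2 s1 by simp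
  have x: "arrays s4 ax p = listed_vertex ps p" if "p < 2 * ?len" for p
    using that ax[of p] ax[of "p - ?len"] by (auto simp: listed_vertex_def)
  have pre: "regs s4 rm = 2 * ?len" "arrays s4 apos = (\<lambda>_. 0)" using s1 u2 u3 u4 by simp_all
  obtain t5 s5 where e5: "exec compute_positions s4 t5 s5" "t5 \<le> 2 * ?len * 14 + 6"
    and q5: "position_of (2 * ?len) (listed_vertex ps) (arrays s5 apos)"
    and u5: "unchanged compute_positions s4 s5"
    using run_compute_positions[OF pre x] by (rule runE)
  note u5 = u5[unfolded unchanged_def compute_positions_def, simplified]
  have "run toggle_adjacency (?len * 50 + 6) s5
      (\<lambda>s'. arrays s' 0 = adjacency n (toggle E ((\<lambda>(u, v). {u, v}) ` set ps)))"
    by (rule run_toggle_adjacency) (use s1 q2 ax u2 u3 u4 u5 ps in auto)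
  then obtain t6 s6 where e6: "exec toggle_adjacency s5 t6 s6" "t6 \<le> ?len * 50 + 6"
    and q6: "arrays s6 0 = adjacency n (toggle E ((\<lambda>(u, v). {u, v}) ` set ps))"
    and u6: "unchanged toggle_adjacency s5 s6"
    by (rule runE)
  note u6 = u6[unfolded unchanged_def toggle_adjacency_def, simplified]
  have "exec prepare ?s (t1 + (t2 + (t3 + (t4 + (t5 + t6))))) s6"
    unfolding prepare_def using e1 e2 e3 e4 e5 e6 by (intro exec.Seq)
  moreover have "t1 + (t2 + (t3 + (t4 + (t5 + t6)))) \<le> 120 * (n * n + n + ?len + 1)"
    using e1 e2 e3 e4 e5 e6 by simp
  moreover have "prepared n E (2 * ?len) (listed_vertex ps) s6"
    using s1 u2 u3 u4 u5 u6 x q2 q3 q5 by (simp add: prepared_def)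
  moreover have "arrays s6 aX = (\<lambda>_. 0)" using s1 u2 u3 u4 u5 u6 by simp
  moreover have "agree_below K s6 (graph_input n (toggle E ((\<lambda>(u, v). {u, v}) ` set ps)))"
    unfolding agree_below_def
  proof (intro allI impI conjI)
    fix y assume y: "y < K"
    show "regs s6 y = regs (graph_input n (toggle E ((\<lambda>(u, v). {u, v}) ` set ps))) y"
      using y s1 u2 u3 u4 u5 u6 by (cases "y = 0") (simp_all add: graph_input_def)
    have "arrays s3 1 = arrays s1 1" "arrays s3 2 = arrays s1 2" using u2 u3 by simp_all
    \<comment> \<open>Beyond the length of the list these arrays were zero from the start, so now
      they are zero everywhere.\<close>
    then have "arrays s4 1 = (\<lambda>_. 0)" "arrays s4 2 = (\<lambda>_. 0)" using q4 s1(9,10) by auto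
    then have "arrays s6 1 = (\<lambda>_. 0)" "arrays s6 2 = (\<lambda>_. 0)" using u5 u6 by simp_all
    moreover have "arrays s6 y = (\<lambda>_. 0)" if "y > 2"
      using that y s1 u2 u3 u4 u5 u6 by simp
    ultimately have "arrays s6 y = (\<lambda>_. 0)" if "y > 0"
      using that by (metis One_nat_def Suc_lessI numeral_2_eq_2)
    then show "arrays s6 y = arrays (graph_input n (toggle E ((\<lambda>(u, v). {u, v}) ` set ps))) y"
      using q6 by (cases "y = 0") (simp_all add: graph_input_def adjacency_def)
  qed
  ultimately show ?thesis unfolding run_def by blast
qed

section \<open>Brute-force search\<close>

definition "compare_intervals = For rj (Reg rm)
  (Cond (Conj
     (Neg (Less (Plus (Load aX (Plus (Reg ridx) (Reg rq))) (Load aX (Plus (Plus (Reg ridx) (Reg rm)) (Reg rq))))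
        (Load aX (Plus (Reg ridx) (Reg rp)))))
     (Neg (Less (Plus (Load aX (Plus (Reg ridx) (Reg rp))) (Load aX (Plus (Plus (Reg ridx) (Reg rm)) (Reg rp))))
        (Load aX (Plus (Reg ridx) (Reg rq))))))
    Skip (Assign rall (Const 0)) ;;
   Assign ridx (Plus (Reg ridx) (Reg rB)))"

lemma run_compare_intervals:
  assumes "regs s rm = m" "regs s rB = 2 * m" "regs s rp = p" "regs s rq = q"
    "regs s rall = 1" "regs s ridx = 0" "arrays s aX = X"
  shows "run compare_intervals (m * 50 + 6) s (\<lambda>s'. regs s' rall =
    (if \<forall>j<m. X (j * (2 * m) + p) \<le> X (j * (2 * m) + q) + X (j * (2 * m) + m + q) \<and>
               X (j * (2 * m) + q) \<le> X (j * (2 * m) + p) + X (j * (2 * m) + m + p) then 1 else 0))"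
  unfolding compare_intervals_def
  by (rule run_For_loop_free[where N = m and I = "\<lambda>i s'. regs s' ridx = i * (2 * m) \<and> regs s' rall =
    (if \<forall>j<i. X (j * (2 * m) + p) \<le> X (j * (2 * m) + q) + X (j * (2 * m) + m + q) \<and>
               X (j * (2 * m) + q) \<le> X (j * (2 * m) + p) + X (j * (2 * m) + m + p) then 1 else 0)"])
    (use assms in \<open>auto simp: unchanged_def less_Suc_eq not_less\<close>)

text \<open>Both the matrix entry and \<open>rall\<close> are 0 or 1, so one equality test decides
  the equivalence between adjacency and intersection in all blocks.\<close>

definition "check_pair =
  (Assign rall (Const 1) ;; Assign ridx (Const 0)) ;; compare_intervals ;;
  Cond (Equal (Load ax (Reg rp)) (Load ax (Reg rq))) Skip
   (Cond (Equal (Load aadj (Plus (Load arow (Load ax (Reg rp))) (Load ax (Reg rq)))) (Reg rall)) Skip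
     (Assign rfound (Const 0)))"

definition good_pair :: "nat \<Rightarrow> (nat \<Rightarrow> nat) \<Rightarrow> nat set set \<Rightarrow> (nat \<Rightarrow> nat) \<Rightarrow> nat \<Rightarrow> nat \<Rightarrow> bool" where
  "good_pair m x E X p q \<longleftrightarrow> (x p \<noteq> x q \<longrightarrow> ({x p, x q} \<in> E \<longleftrightarrow>
     (\<forall>j<m. X (j * (2 * m) + p) \<le> X (j * (2 * m) + q) + X (j * (2 * m) + m + q) \<and>
            X (j * (2 * m) + q) \<le> X (j * (2 * m) + p) + X (j * (2 * m) + m + p))))"

lemma good_digits_iff_good_pair:
  "good_digits m x E m X \<longleftrightarrow> (\<forall>p<m. \<forall>q<m. good_pair m x E X p q)"
  by (simp add: good_digits_def good_pair_def)

lemma prepared_unchanged: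
  assumes "prepared n E m x s" "unchanged c s s'"
    "rn \<notin> written_regs c" "rm \<notin> written_regs c"
    "{ax, apos, aadj, arow} \<inter> written_arrays c = {}"
  shows "prepared n E m x s'"
  using assms by (simp add: prepared_def unchanged_def)

lemma run_check_pair:
  assumes "prepared n E m x s" "p < m" "q < m" and x: "\<And>p. p < m \<Longrightarrow> x p < n"
    and "regs s rB = 2 * m" "regs s rp = p" "regs s rq = q" "arrays s aX = X"
  shows "run check_pair (m * 50 + 50) s (\<lambda>s'. regs s' rfound =
    (if good_pair m x E X p q then regs s rfound else 0))"
proof -
  let ?c = "Assign rall (Const 1) ;; Assign ridx (Const 0)"
  define s1 where "s1 = result ?c s"
  have "run ?c 4 s (\<lambda>s'. s' = s1)" by (rule run_loop_free) (auto simp: s1_def)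
  then obtain t1 where e1: "exec ?c s t1 s1" "t1 \<le> 4" by (auto elim: runE)
  have pr: "prepared n E m x s1" using assms by (simp add: s1_def prepared_def)
  have "run compare_intervals (m * 50 + 6) s1 (\<lambda>s'. regs s' rall =
    (if \<forall>j<m. X (j * (2 * m) + p) \<le> X (j * (2 * m) + q) + X (j * (2 * m) + m + q) \<and>
               X (j * (2 * m) + q) \<le> X (j * (2 * m) + p) + X (j * (2 * m) + m + p) then 1 else 0))"
    by (rule run_compare_intervals) (use assms pr in \<open>auto simp: s1_def prepared_def\<close>)
  then obtain t2 s2 where e2: "exec compare_intervals s1 t2 s2" "t2 \<le> m * 50 + 6"
    and q2: "regs s2 rall =
    (if \<forall>j<m. X (j * (2 * m) + p) \<le> X (j * (2 * m) + q) + X (j * (2 * m) + m + q) \<and>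
               X (j * (2 * m) + q) \<le> X (j * (2 * m) + p) + X (j * (2 * m) + m + p) then 1 else 0)"
    and u2: "unchanged compare_intervals s1 s2" by (rule runE)
  have pr2: "prepared n E m x s2"
    by (rule prepared_unchanged[OF pr u2]) (auto simp: compare_intervals_def)
  note u2 = u2[unfolded unchanged_def compare_intervals_def, simplified]
  let ?d = "Cond (Equal (Load ax (Reg rp)) (Load ax (Reg rq))) Skip
   (Cond (Equal (Load aadj (Plus (Load arow (Load ax (Reg rp))) (Load ax (Reg rq)))) (Reg rall)) Skip
     (Assign rfound (Const 0)))"
  have regs2: "regs s2 rp = p" "regs s2 rq = q" "regs s2 rfound = regs s rfound"
    using u2 assms by (simp_all add: s1_def)
  have adj: "arrays s2 aadj (x p * n + x q) = (if {x p, x q} \<in> E then 1 else 0)"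
    using pr2 x assms(2,3) by (simp add: prepared_def index_less adjacency_index)
  have "run ?d 30 s2 (\<lambda>s'. regs s' rfound = (if good_pair m x E X p q then regs s rfound else 0))"
    by (rule run_loop_free)
      (use pr2 x assms(2,3) in \<open>auto simp: regs2 prepared_def adj q2 good_pair_def\<close>)
  then obtain t3 s3 where e3: "exec ?d s2 t3 s3" "t3 \<le> 30"
    and q3: "regs s3 rfound = (if good_pair m x E X p q then regs s rfound else 0)" by (rule runE)
  have "exec check_pair s (t1 + (t2 + t3)) s3"
    unfolding check_pair_def using e1 e2 e3 by (intro exec.Seq)
  moreover have "t1 + (t2 + t3) \<le> m * 50 + 50" using e1 e2 e3 by simp
  ultimately show ?thesis unfolding run_def using q3 by blast
qed

definition "check = Assign rfound (Const 1) ;; For rp (Reg rm) (For rq (Reg rm) check_pair)"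

lemma written_check_pair [simp]:
  "written_regs check_pair = {rall, ridx, rj, rfound}" "written_arrays check_pair = {}"
  by (auto simp: check_pair_def compare_intervals_def)

lemma written_check [simp]:
  "written_regs check = {rall, ridx, rj, rfound, rp, rq}" "written_arrays check = {}"
  by (auto simp: check_def)

definition "check_time m = m * (m * (m * 50 + 58) + 14) + 8" for m :: nat

lemma run_check:
  assumes pr: "prepared n E m x s" and x: "\<And>p. p < m \<Longrightarrow> x p < n"
    and B: "regs s rB = 2 * m" and X: "arrays s aX = X"
  shows "run check (check_time m) s (\<lambda>s'. regs s' rfound = (if good_digits m x E m X then 1 else 0))"
  unfolding check_def
proof (rule run_Seq)
  show "run (Assign rfound (Const 1)) 2 s (\<lambda>s'. s' = result (Assign rfound (Const 1)) s)"
    by (rule run_loop_free) auto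
  show "2 + (m * (m * (m * 50 + 58) + 6 + 8) + 6) \<le> check_time m"
    by (simp add: check_time_def algebra_simps)
  fix s1 assume s1: "s1 = result (Assign rfound (Const 1)) s"
  have pr1: "prepared n E m x s1" "regs s1 rfound = 1" "regs s1 rB = 2 * m" "arrays s1 aX = X"
    using pr B X by (simp_all add: s1 prepared_def)
  have "run (For rp (Reg rm) (For rq (Reg rm) check_pair)) (m * (m * (m * 50 + 58) + 6 + 8) + 6) s1
    (\<lambda>s'. regs s' rfound = (if \<forall>p'<m. \<forall>q<m. good_pair m x E X p' q then 1 else 0) \<and> regs s' rp = m)"
  proof (rule run_For[where N = m and
        I = "\<lambda>i s'. regs s' rfound = (if \<forall>p'<i. \<forall>q<m. good_pair m x E X p' q then 1 else 0)"])
    fix p s'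
    assume p: "p < m" "regs s' rp = p"
      "regs s' rfound = (if \<forall>p'<p. \<forall>q<m. good_pair m x E X p' q then 1 else 0)"
      and u: "unchanged (For rp (Reg rm) (For rq (Reg rm) check_pair)) s1 s'"
    have pr': "prepared n E m x s'" by (rule prepared_unchanged[OF pr1(1) u]) auto
    have s': "regs s' rB = 2 * m" "arrays s' aX = X" using u pr1 by (auto simp: unchanged_def)
    have "run (For rq (Reg rm) check_pair) (m * (m * 50 + 50 + 8) + 6) s'
      (\<lambda>t. regs t rfound = (if (\<forall>p'<p. \<forall>q<m. good_pair m x E X p' q) \<and> (\<forall>q<m. good_pair m x E X p q)
         then 1 else 0) \<and> regs t rq = m)"
    proof (rule run_For[where N = m and I = "\<lambda>i t. regs t rfound =
          (if (\<forall>p'<p. \<forall>q<m. good_pair m x E X p' q) \<and> (\<forall>q<i. good_pair m x E X p q) then 1 else 0)"])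
      fix q t
      assume q: "q < m" "regs t rq = q"
        "regs t rfound = (if (\<forall>p'<p. \<forall>q<m. good_pair m x E X p' q) \<and> (\<forall>q'<q. good_pair m x E X p q')
         then 1 else 0)"
        and u: "unchanged (For rq (Reg rm) check_pair) s' t"
      have "prepared n E m x t" by (rule prepared_unchanged[OF pr' u]) auto
      moreover have "regs t rB = 2 * m" "arrays t aX = X" "regs t rp = p"
        using u s' p by (auto simp: unchanged_def)
      ultimately have "run check_pair (m * 50 + 50) t (\<lambda>s'. regs s' rfound =
          (if good_pair m x E X p q then regs t rfound else 0))"
        using p q x by (intro run_check_pair) auto
      then show "run check_pair (m * 50 + 50) t (\<lambda>s'. regs ((regs s')(rq := Suc q), arrays s') rfound =
        (if (\<forall>p'<p. \<forall>q<m. good_pair m x E X p' q) \<and> (\<forall>q'<Suc q. good_pair m x E X p q') then 1 else 0))"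
        by (rule run_weaken) (auto simp: q less_Suc_eq)
    qed (use p pr' in \<open>auto simp: unchanged_def prepared_def\<close>)
    then show "run (For rq (Reg rm) check_pair) (m * (m * 50 + 58) + 6) s'
      (\<lambda>s'. regs ((regs s')(rp := Suc p), arrays s') rfound =
        (if \<forall>p'<Suc p. \<forall>q<m. good_pair m x E X p' q then 1 else 0))"
      by (rule run_weaken) (auto simp: less_Suc_eq)
  qed (use pr1 in \<open>auto simp: unchanged_def prepared_def\<close>)
  then show "run (For rp (Reg rm) (For rq (Reg rm) check_pair)) (m * (m * (m * 50 + 58) + 6 + 8) + 6) s1
    (\<lambda>s'. regs s' rfound = (if good_digits m x E m X then 1 else 0))"
    by (rule run_weaken) (auto simp: good_digits_iff_good_pair)
qed

text \<open>All \<open>rL\<close> digits are visited even after the carry has died out; this cost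
  per candidate is absorbed by the exponential term.\<close>

definition "increment = Assign rcarry (Const 1) ;; For ri (Reg rL)
  (Cond (Equal (Reg rcarry) (Const 1))
    (Cond (Equal (Plus (Load aX (Reg ri)) (Const 1)) (Reg rB))
      (Store aX (Reg ri) (Const 0))
      (Store aX (Reg ri) (Plus (Load aX (Reg ri)) (Const 1)) ;; Assign rcarry (Const 0)))
    Skip)"

lemma written_increment [simp]:
  "written_regs increment = {rcarry, ri}" "written_arrays increment = {aX}"
  by (auto simp: increment_def)

lemma run_increment:
  assumes L: "regs s rL = L" and B: "regs s rB = B" "B > 0" and X: "arrays s aX = digit B N"
    and N: "Suc N < B ^ L"
  shows "run increment (L * 27 + 8) s (\<lambda>s'. arrays s' aX = digit B (Suc N))"
  unfolding increment_def
proof (rule run_Seq)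
  show "run (Assign rcarry (Const 1)) 2 s (\<lambda>s'. s' = result (Assign rcarry (Const 1)) s)"
    by (rule run_loop_free) auto
  show "2 + (L * 27 + 6) \<le> L * 27 + 8" by simp
  fix s1 assume s1: "s1 = result (Assign rcarry (Const 1)) s"
  show "run (For ri (Reg rL)
     (Cond (Equal (Reg rcarry) (Const 1))
      (Cond (Equal (Plus (Load aX (Reg ri)) (Const 1)) (Reg rB))
        (Store aX (Reg ri) (Const 0))
        (Store aX (Reg ri) (Plus (Load aX (Reg ri)) (Const 1)) ;; Assign rcarry (Const 0)))
      Skip)) (L * 27 + 6) s1 (\<lambda>s'. arrays s' aX = digit B (Suc N))"
  proof (rule run_For_loop_free[where N = L and I = "\<lambda>i s'.
      arrays s' aX = (\<lambda>k. if k < i then digit B (Suc N) k else digit B N k) \<and>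
      regs s' rcarry = (if Suc N mod B ^ i = 0 then 1 else 0)"], goal_cases)
    case (6 i s')
    have B': "regs s' rB = B" using 6(4) B by (simp add: unchanged_def s1)
    show ?case
      using 6(1-3) B' B(2) mod_power_Suc_eq_0_iff[OF B(2), of "Suc N" i] digit_Suc[of B N i]
      by (auto simp: fun_eq_iff less_Suc_eq simp del: power_Suc)
  next
    case (8 s')
    \<comment> \<open>From position \<open>L\<close> on the loop writes nothing; both numbers have
      zero digits there because \<open>Suc N < B ^ L\<close>.\<close>
    then show ?case using digit_eq_0[OF N] digit_eq_0[of N B L] N by (auto simp: fun_eq_iff)
  qed (use L B X in \<open>auto simp: s1 unchanged_def\<close>)
qed

definition "search =
  (Assign rB (Plus (Reg rm) (Reg rm)) ;; Assign rL (Const 0)) ;;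
  For rj (Reg rm) (Assign rL (Plus (Reg rL) (Reg rB))) ;;
  check ;; While (Equal (Reg rfound) (Const 0)) (increment ;; check)"

lemma written_search [simp]:
  "written_regs search = {rall, ridx, rj, rfound, rp, rq, rcarry, ri, rB, rL}"
  "written_arrays search = {aX}"
  by (auto simp: search_def)

text \<open>The power bounds the number of rounds; 12 joins the 4 steps of the guard with the
  constant 8 of \<open>increment\<close>.\<close>

definition "search_time m = (2 * m) ^ (m * (2 * m)) * (m * (2 * m) * 27 + 12 + check_time m) +
  m * 12 + 20 + check_time m" for m :: nat

text \<open>The last conjunct makes the number found the least good one, and thereby bounds the
  dimension.\<close>

definition searched :: "nat \<Rightarrow> (nat \<Rightarrow> nat) \<Rightarrow> nat set set \<Rightarrow> nat \<Rightarrow> state \<Rightarrow> bool" where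
  "searched m x E N s \<longleftrightarrow> regs s rB = 2 * m \<and> regs s rL = m * (2 * m) \<and> arrays s aX = digit (2 * m) N \<and>
     (\<forall>N'<N. \<not> good_digits m x E m (digit (2 * m) N'))"

lemma run_search:
  assumes pr: "prepared n E m x s" and x: "\<And>p. p < m \<Longrightarrow> x p < n"
    and X: "arrays s aX = (\<lambda>_. 0)"
  shows "run search (search_time m) s (\<lambda>s'. \<exists>N. searched m x E N s' \<and> good_digits m x E m (digit (2 * m) N))"
proof -
  let ?L = "m * (2 * m)"
  let ?good = "\<lambda>N. good_digits m x E m (digit (2 * m) N)"
  \<comment> \<open>\<open>N0\<close> bounds the number of rounds in the proof; the program does not
    know it.\<close>
  obtain N0 where N0: "N0 < (2 * m) ^ ?L" "?good N0" using ex_good_digits_length by blast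
  let ?c = "Assign rB (Plus (Reg rm) (Reg rm)) ;; Assign rL (Const 0)"
  define s1 where "s1 = result ?c s"
  have "run ?c 6 s (\<lambda>s'. s' = s1)" by (rule run_loop_free) (auto simp: s1_def)
  then obtain t1 where e1: "exec ?c s t1 s1" "t1 \<le> 6" by (auto elim: runE)
  have s1: "prepared n E m x s1" "regs s1 rB = 2 * m" "regs s1 rL = 0" "arrays s1 aX = (\<lambda>_. 0)"
    using pr X by (simp_all add: s1_def prepared_def)
  let ?d = "For rj (Reg rm) (Assign rL (Plus (Reg rL) (Reg rB)))"
  have "run ?d (m * 12 + 6) s1 (\<lambda>s'. regs s' rL = ?L)"
    by (rule run_For_loop_free[where N = m and I = "\<lambda>i s'. regs s' rL = i * (2 * m)"])
      (use s1 in \<open>auto simp: unchanged_def prepared_def\<close>)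
  then obtain t2 s2 where e2: "exec ?d s1 t2 s2" "t2 \<le> m * 12 + 6" and L: "regs s2 rL = ?L"
    and u2: "unchanged ?d s1 s2" by (rule runE)
  have s2: "prepared n E m x s2" "regs s2 rB = 2 * m" "arrays s2 aX = (\<lambda>_. 0)"
    using s1 u2 by (auto simp: prepared_def unchanged_def)
  obtain t3 s3 where e3: "exec check s2 t3 s3" "t3 \<le> check_time m"
    and q3: "regs s3 rfound = (if good_digits m x E m (\<lambda>_. 0) then 1 else 0)"
    and u3: "unchanged check s2 s3"
    using run_check[OF s2(1) x s2(2,3)] by (rule runE)
  have s3: "prepared n E m x s3" "regs s3 rB = 2 * m" "regs s3 rL = ?L" "arrays s3 aX = (\<lambda>_. 0)"
    using s2 u3 L by (auto simp: prepared_def unchanged_def)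
  define I where "I i s' \<longleftrightarrow> prepared n E m x s' \<and> searched m x E i s' \<and>
    regs s' rfound = (if ?good i then 1 else 0)" for i s'
  let ?w = "While (Equal (Reg rfound) (Const 0)) (increment ;; check)"
  have "run ?w (N0 * (1 + bcost (Equal (Reg rfound) (Const 0)) + (?L * 27 + 8 + check_time m)) + 1 +
      bcost (Equal (Reg rfound) (Const 0))) s3
    (\<lambda>s'. \<exists>i. I i s' \<and> \<not> bval (Equal (Reg rfound) (Const 0)) s')"
  proof (rule run_While)
    show "I 0 s3" using s3 q3 by (simp add: I_def searched_def)
    fix i s'
    assume I: "I i s'" and b: "bval (Equal (Reg rfound) (Const 0)) s'"
    have ng: "\<not> ?good i" using I b by (auto simp: I_def)
    \<comment> \<open>Otherwise the good number \<open>N0\<close> would be either \<open>i\<close>,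
      which is bad, or one of those already rejected.\<close>
    have less: "i < N0"
    proof (rule ccontr)
      assume "\<not> i < N0"
      then show False using ng I N0(2) unfolding I_def searched_def by (metis nat_neq_iff)
    qed
    \<comment> \<open>Without listed vertices every number is good and the loop is not entered, so
      the base is positive inside it.\<close>
    have m: "m > 0" using ng by (cases m) (auto simp: good_digits_def)
    have "run (increment ;; check) (?L * 27 + 8 + check_time m) s' (I (Suc i))"
    proof (rule run_Seq[OF _ _ order.refl])
      show "run increment (?L * 27 + 8) s' (\<lambda>s'. arrays s' aX = digit (2 * m) (Suc i))"
        using I m N0(1) less by (intro run_increment) (auto simp: I_def searched_def)
      fix s'' assume X': "arrays s'' aX = digit (2 * m) (Suc i)" and u: "unchanged increment s' s''"
      have s'': "prepared n E m x s''" "regs s'' rB = 2 * m" "regs s'' rL = ?L"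
        using I u by (auto simp: I_def prepared_def searched_def unchanged_def)
      show "run check (check_time m) s'' (I (Suc i))"
        by (rule run_weaken[OF run_check[OF s''(1) x s''(2) X']])
          (use s'' X' ng I in \<open>auto simp: I_def searched_def prepared_def unchanged_def less_Suc_eq\<close>)
    qed
    then show "i < N0 \<and> run (increment ;; check) (?L * 27 + 8 + check_time m) s' (I (Suc i))"
      using less by blast
  qed
  then obtain t4 s4 where e4: "exec ?w s3 t4 s4" 
      "t4 \<le> N0 * (1 + bcost (Equal (Reg rfound) (Const 0)) + (?L * 27 + 8 + check_time m)) + 1 +
      bcost (Equal (Reg rfound) (Const 0))"
    and q4: "\<exists>i. I i s4 \<and> \<not> bval (Equal (Reg rfound) (Const 0)) s4" by (rule runE)
  have "exec search s (t1 + (t2 + (t3 + t4))) s4"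
    unfolding search_def using e1 e2 e3 e4 by (intro exec.Seq)
  moreover have "t1 + (t2 + (t3 + t4)) \<le> search_time m"
  proof -
    have "N0 * (?L * 27 + 12 + check_time m) \<le> (2 * m) ^ ?L * (?L * 27 + 12 + check_time m)"
      using N0 by (intro mult_le_mono1) simp
    moreover have "t4 \<le> N0 * (?L * 27 + 12 + check_time m) + 4" using e4(2) by (simp add: add_ac)
    ultimately show ?thesis using e1(2) e2(2) e3(2) unfolding search_time_def by linarith
  qed
  moreover have "\<exists>N. searched m x E N s4 \<and> ?good N" using q4 by (auto simp: I_def split: if_splits)
  ultimately show ?thesis unfolding run_def by blast
qed

text \<open>\<open>rj\<close> and \<open>rp\<close> are quotient and remainder of \<open>ri\<close>
  by \<open>2 * m\<close>, kept by counting because there is no division. \<open>rd\<close> ends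
  just behind the last nonzero block.\<close>

definition "count_blocks = (Assign rd (Const 0) ;; Assign rj (Const 0) ;; Assign rp (Const 0)) ;;
  For ri (Reg rL)
   (Cond (Equal (Load aX (Reg ri)) (Const 0)) Skip (Assign rd (Plus (Reg rj) (Const 1))) ;;
    Assign rp (Plus (Reg rp) (Const 1)) ;;
    Cond (Equal (Reg rp) (Reg rB)) (Assign rp (Const 0) ;; Assign rj (Plus (Reg rj) (Const 1))) Skip)"

lemma written_count_blocks [simp]:
  "written_regs count_blocks = {rd, rj, rp, ri}" "written_arrays count_blocks = {}"
  by (auto simp: count_blocks_def)

lemma run_count_blocks:
  assumes "regs s rB = B" "regs s rL = L" "B > 0 \<or> L = 0" "arrays s aX = X"
  shows "run count_blocks (L * 40 + 20) s (\<lambda>s'. (\<forall>k<L. regs s' rd * B \<le> k \<longrightarrow> X k = 0) \<and>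
    (\<forall>d. (\<forall>k\<ge>d * B. X k = 0) \<longrightarrow> regs s' rd \<le> d))"
  unfolding count_blocks_def
proof (rule run_Seq)
  let ?c = "Assign rd (Const 0) ;; Assign rj (Const 0) ;; Assign rp (Const 0)"
  show "run ?c 6 s (\<lambda>s'. s' = result ?c s)" by (rule run_loop_free) auto
  show "6 + (L * 40 + 10) \<le> L * 40 + 20" by simp
  fix s1 assume s1: "s1 = result ?c s"
  show "run (For ri (Reg rL)
   (Cond (Equal (Load aX (Reg ri)) (Const 0)) Skip (Assign rd (Plus (Reg rj) (Const 1))) ;;
    Assign rp (Plus (Reg rp) (Const 1)) ;;
    Cond (Equal (Reg rp) (Reg rB)) (Assign rp (Const 0) ;; Assign rj (Plus (Reg rj) (Const 1))) Skip))
    (L * 40 + 10) s1 (\<lambda>s'. (\<forall>k<L. regs s' rd * B \<le> k \<longrightarrow> X k = 0) \<and>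
    (\<forall>d. (\<forall>k\<ge>d * B. X k = 0) \<longrightarrow> regs s' rd \<le> d))"
  proof (rule run_For_loop_free[where N = L and I = "\<lambda>i s'. regs s' rj = i div B \<and> regs s' rp = i mod B \<and>
      (\<forall>k<i. regs s' rd * B \<le> k \<longrightarrow> X k = 0) \<and> (\<forall>d. (\<forall>k\<ge>d * B. X k = 0) \<longrightarrow> regs s' rd \<le> d)"], goal_cases)
    case (6 i s')
    have B: "B > 0" using assms 6(1) by auto
    have s': "regs s' rB = B" "arrays s' aX = X" using 6(4) assms by (auto simp: unchanged_def s1)
    have block: "i < Suc (i div B) * B" using B by (simp add: dividend_less_div_times)
    \<comment> \<open>A nonzero digit at \<open>i\<close> forces \<open>i < d * B\<close>, so its
      block lies below \<open>d\<close>.\<close>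
    have dmin: "Suc (i div B) \<le> d" if "X i \<noteq> 0" "\<forall>k\<ge>d * B. X k = 0" for d
      using that B by (metis Suc_leI less_mult_imp_div_less not_le)
    have dm: "Suc i div B = (if Suc (i mod B) = B then Suc (i div B) else i div B)"
      "Suc i mod B = (if Suc (i mod B) = B then 0 else Suc (i mod B))"
      by (auto simp: div_Suc mod_Suc)
    show ?case
    proof (cases "X i = 0")
      case True
      then show ?thesis using 6(2,3) s' by (auto simp: dm less_Suc_eq)
    next
      case False
      have "\<not> Suc (i div B) * B \<le> k" if "k < Suc i" for k using that block by linarith
      then show ?thesis using False 6(2,3) s' dmin by (auto simp: dm simp del: mult_Suc)
    qed
  qed (use assms in \<open>auto simp: s1 unchanged_def\<close>)
qed

section \<open>Writing the output\<close>

text \<open>\<open>rR\<close> sums up the right endpoints: stretching to the right only asks for a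
  common upper bound, and a sum needs no comparisons.\<close>

definition "compute_bounds b = (Assign rbn (Const 0) ;; Assign rR (Const 0)) ;;
  For rj (Const b) (Assign rbn (Plus (Reg rbn) (Reg rn))) ;;
  For ri (Reg rbn) (Assign rR (Plus (Reg rR) (Load 1 (Reg ri))))"

lemma written_compute_bounds [simp]:
  "written_regs (compute_bounds b) = {rbn, rR, rj, ri}" "written_arrays (compute_bounds b) = {}"
  by (auto simp: compute_bounds_def)

lemma run_compute_bounds:
  assumes "regs s rn = n"
  shows "run (compute_bounds b) (b * 12 + b * n * 13 + 16) s (\<lambda>s'. regs s' rbn = b * n \<and>
    (\<forall>k<b * n. arrays s' 1 k \<le> regs s' rR))"
  unfolding compute_bounds_def
proof (rule run_Seq)
  let ?c = "Assign rbn (Const 0) ;; Assign rR (Const 0)"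
  let ?d = "For rj (Const b) (Assign rbn (Plus (Reg rbn) (Reg rn)))"
  let ?e = "For ri (Reg rbn) (Assign rR (Plus (Reg rR) (Load 1 (Reg ri))))"
  show "run ?c 4 s (\<lambda>s'. s' = result ?c s)" by (rule run_loop_free) auto
  show "4 + ((b * 12 + 6) + (b * n * 13 + 6)) \<le> b * 12 + b * n * 13 + 16" by simp
  fix s1 assume s1: "s1 = result ?c s"
  show "run (?d ;; ?e) ((b * 12 + 6) + (b * n * 13 + 6)) s1
    (\<lambda>s'. regs s' rbn = b * n \<and> (\<forall>k<b * n. arrays s' 1 k \<le> regs s' rR))"
  proof (rule run_Seq[OF _ _ order.refl])
    show "run ?d (b * 12 + 6) s1 (\<lambda>s'. regs s' rbn = b * n)"
      by (rule run_For_loop_free[where N = b and I = "\<lambda>i s'. regs s' rbn = i * n"])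
        (use assms in \<open>auto simp: s1 unchanged_def\<close>)
    fix s2 assume s2: "regs s2 rbn = b * n" "unchanged ?d s1 s2"
    show "run ?e (b * n * 13 + 6) s2
      (\<lambda>s'. regs s' rbn = b * n \<and> (\<forall>k<b * n. arrays s' 1 k \<le> regs s' rR))"
      by (rule run_For_loop_free[where N = "b * n" and I = "\<lambda>i s'. \<forall>k<i. arrays s2 1 k \<le> regs s' rR"])
        (use s2 in \<open>auto simp: unchanged_def less_Suc_eq intro: trans_le_add1\<close>)
  qed
qed

text \<open>The left-stretched copy replaces the original in place, the right-stretched copy goes
  behind it. Each entry is copied before its left endpoint is overwritten by 0.\<close>

definition "stretch = Assign rv (Const 0) ;; For ri (Reg rbn)
  (Store 0 (Plus (Reg rbn) (Reg ri)) (Load 0 (Reg ri)) ;;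
   Cond (Equal (Load apos (Reg rv)) (Const 0))
     (Store 1 (Plus (Reg rbn) (Reg ri)) (Load 1 (Reg ri)))
     (Store 1 (Plus (Reg rbn) (Reg ri)) (Reg rR) ;; Store 0 (Reg ri) (Const 0)) ;;
   Assign rv (Plus (Reg rv) (Const 1)) ;;
   Cond (Equal (Reg rv) (Reg rn)) (Assign rv (Const 0)) Skip)"

lemma written_stretch [simp]:
  "written_regs stretch = {rv, ri}" "written_arrays stretch = {0, 1}"
  by (auto simp: stretch_def)

lemma run_stretch:
  assumes "regs s rn = n" "regs s rbn = b * n" "regs s rR = R" "arrays s apos = pos"
  shows "run stretch (b * n * 60 + 20) s (\<lambda>s'. \<forall>k<b * n.
    arrays s' 0 k = (if pos (k mod n) = 0 then arrays s 0 k else 0) \<and> arrays s' 1 k = arrays s 1 k \<and>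
    arrays s' 0 (b * n + k) = arrays s 0 k \<and>
    arrays s' 1 (b * n + k) = (if pos (k mod n) = 0 then arrays s 1 k else R))"
  unfolding stretch_def
proof (rule run_Seq)
  let ?c = "Assign rv (Const 0)"
  let ?d = "For ri (Reg rbn)
    (Store 0 (Plus (Reg rbn) (Reg ri)) (Load 0 (Reg ri)) ;;
     Cond (Equal (Load apos (Reg rv)) (Const 0))
       (Store 1 (Plus (Reg rbn) (Reg ri)) (Load 1 (Reg ri)))
       (Store 1 (Plus (Reg rbn) (Reg ri)) (Reg rR) ;; Store 0 (Reg ri) (Const 0)) ;;
     Assign rv (Plus (Reg rv) (Const 1)) ;;
     Cond (Equal (Reg rv) (Reg rn)) (Assign rv (Const 0)) Skip)"
  show "run ?c 2 s (\<lambda>s'. s' = result ?c s)" by (rule run_loop_free) auto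
  show "2 + (b * n * 60 + 10) \<le> b * n * 60 + 20" by simp
  fix s1 assume s1: "s1 = result ?c s"
  show "run ?d (b * n * 60 + 10) s1 (\<lambda>s'. \<forall>k<b * n.
    arrays s' 0 k = (if pos (k mod n) = 0 then arrays s 0 k else 0) \<and> arrays s' 1 k = arrays s 1 k \<and>
    arrays s' 0 (b * n + k) = arrays s 0 k \<and>
    arrays s' 1 (b * n + k) = (if pos (k mod n) = 0 then arrays s 1 k else R))"
  \<comment> \<open>Since the loop works in place, the invariant must say that entries not yet
    visited are still the original ones.\<close>
  proof (rule run_For_loop_free[where N = "b * n" and I = "\<lambda>i s'. regs s' rv = i mod n \<and>
      (\<forall>k<b * n. arrays s' 1 k = arrays s 1 k \<and> (i \<le> k \<longrightarrow> arrays s' 0 k = arrays s 0 k)) \<and>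
      (\<forall>k<i. arrays s' 0 k = (if pos (k mod n) = 0 then arrays s 0 k else 0) \<and>
        arrays s' 0 (b * n + k) = arrays s 0 k \<and>
        arrays s' 1 (b * n + k) = (if pos (k mod n) = 0 then arrays s 1 k else R))"], goal_cases)
    case (6 i s')
    have s': "regs s' rn = n" "regs s' rbn = b * n" "regs s' rR = R" "arrays s' apos = pos"
      using 6(4) assms by (auto simp: unchanged_def s1)
    show ?case using 6(1-3) s' by (auto simp: less_Suc_eq mod_Suc)
  qed (use assms in \<open>auto simp: s1 unchanged_def\<close>)
qed

text \<open>A right endpoint is the sum of two digits below \<open>2 * m\<close>, so the interval
  from 0 to \<open>4 * m\<close> is wide enough for a universal vertex.\<close>

definition "append_blocks = (Assign rL (Const 0) ;; Assign rv (Const 0) ;; Assign ridx (Const 0) ;;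
    Assign rq (Plus (Reg rbn) (Reg rbn))) ;;
  For rj (Reg rd) (Assign rL (Plus (Reg rL) (Reg rn))) ;;
  For ri (Reg rL)
   (Assign rp (Load apos (Reg rv)) ;;
    Cond (Equal (Reg rp) (Const 0))
      (Store 0 (Plus (Reg rq) (Reg ri)) (Const 0) ;; Store 1 (Plus (Reg rq) (Reg ri)) (Plus (Reg rB) (Reg rB)))
      (Assign rp (Plus (Reg ridx) (Minus (Reg rp) (Const 1))) ;;
       Store 0 (Plus (Reg rq) (Reg ri)) (Load aX (Reg rp)) ;;
       Store 1 (Plus (Reg rq) (Reg ri)) (Plus (Load aX (Reg rp)) (Load aX (Plus (Reg rp) (Reg rm))))) ;;
    Assign rv (Plus (Reg rv) (Const 1)) ;;
    Cond (Equal (Reg rv) (Reg rn)) (Assign rv (Const 0) ;; Assign ridx (Plus (Reg ridx) (Reg rB))) Skip)"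

lemma written_append_blocks [simp]:
  "written_regs append_blocks = {rL, rv, ridx, rq, rj, ri, rp}" "written_arrays append_blocks = {0, 1}"
  by (auto simp: append_blocks_def)

lemma run_append_blocks:
  assumes "regs s rn = n" "regs s rbn = b * n" "regs s rB = B" "regs s rm = m" "regs s rd = d"
    and "arrays s apos = pos" "arrays s aX = X"
  shows "run append_blocks (d * 12 + d * n * 60 + 30) s (\<lambda>s'.
    (\<forall>k<b * n + b * n. arrays s' 0 k = arrays s 0 k \<and> arrays s' 1 k = arrays s 1 k) \<and>
    (\<forall>k<d * n. arrays s' 0 (b * n + b * n + k) =
        (if pos (k mod n) = 0 then 0 else X (k div n * B + (pos (k mod n) - 1))) \<and>
      arrays s' 1 (b * n + b * n + k) =
        (if pos (k mod n) = 0 then B + B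
         else X (k div n * B + (pos (k mod n) - 1)) + X (k div n * B + (pos (k mod n) - 1) + m))))"
  unfolding append_blocks_def
proof (rule run_Seq)
  let ?c = "Assign rL (Const 0) ;; Assign rv (Const 0) ;; Assign ridx (Const 0) ;;
    Assign rq (Plus (Reg rbn) (Reg rbn))"
  let ?d = "For rj (Reg rd) (Assign rL (Plus (Reg rL) (Reg rn)))"
  let ?e = "For ri (Reg rL)
   (Assign rp (Load apos (Reg rv)) ;;
    Cond (Equal (Reg rp) (Const 0))
      (Store 0 (Plus (Reg rq) (Reg ri)) (Const 0) ;; Store 1 (Plus (Reg rq) (Reg ri)) (Plus (Reg rB) (Reg rB)))
      (Assign rp (Plus (Reg ridx) (Minus (Reg rp) (Const 1))) ;;
       Store 0 (Plus (Reg rq) (Reg ri)) (Load aX (Reg rp)) ;;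
       Store 1 (Plus (Reg rq) (Reg ri)) (Plus (Load aX (Reg rp)) (Load aX (Plus (Reg rp) (Reg rm))))) ;;
    Assign rv (Plus (Reg rv) (Const 1)) ;;
    Cond (Equal (Reg rv) (Reg rn)) (Assign rv (Const 0) ;; Assign ridx (Plus (Reg ridx) (Reg rB))) Skip)"
  let ?A0 = "\<lambda>k. if pos (k mod n) = 0 then 0 else X (k div n * B + (pos (k mod n) - 1))"
  let ?A1 = "\<lambda>k. if pos (k mod n) = 0 then B + B
         else X (k div n * B + (pos (k mod n) - 1)) + X (k div n * B + (pos (k mod n) - 1) + m)"
  let ?Q = "\<lambda>i s'. (\<forall>k<b * n + b * n. arrays s' 0 k = arrays s 0 k \<and> arrays s' 1 k = arrays s 1 k) \<and>
    (\<forall>k<i. arrays s' 0 (b * n + b * n + k) = ?A0 k \<and> arrays s' 1 (b * n + b * n + k) = ?A1 k)"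
  show "run ?c 10 s (\<lambda>s'. s' = result ?c s)" by (rule run_loop_free) auto
  show "10 + ((d * 12 + 6) + (d * n * 60 + 6)) \<le> d * 12 + d * n * 60 + 30" by simp
  fix s1 assume s1: "s1 = result ?c s"
  show "run (?d ;; ?e) ((d * 12 + 6) + (d * n * 60 + 6)) s1 (?Q (d * n))"
  proof (rule run_Seq[OF _ _ order.refl])
    show "run ?d (d * 12 + 6) s1 (\<lambda>s'. regs s' rL = d * n)"
      by (rule run_For_loop_free[where N = d and I = "\<lambda>i s'. regs s' rL = i * n"])
        (use assms in \<open>auto simp: s1 unchanged_def\<close>)
    fix s2 assume s2: "regs s2 rL = d * n" and u2: "unchanged ?d s1 s2"
    have s2': "regs s2 rn = n" "regs s2 rq = b * n + b * n" "regs s2 rB = B" "regs s2 rm = m"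
      "regs s2 rv = 0" "regs s2 ridx = 0"
      "arrays s2 apos = pos" "arrays s2 aX = X" "arrays s2 0 = arrays s 0" "arrays s2 1 = arrays s 1"
      using u2 assms by (simp_all add: s1 unchanged_def)
    show "run ?e (d * n * 60 + 6) s2 (?Q (d * n))"
    proof (rule run_For_loop_free[where N = "d * n" and
          I = "\<lambda>i s'. regs s' rv = i mod n \<and> regs s' ridx = i div n * B \<and> ?Q i s'"], goal_cases)
      case (6 i s')
      have s': "regs s' rn = n" "regs s' rq = b * n + b * n" "regs s' rB = B" "regs s' rm = m"
        "arrays s' apos = pos" "arrays s' aX = X"
        using 6(4) s2' by (simp_all add: unchanged_def)
      have dm: "Suc i div n = (if Suc (i mod n) = n then Suc (i div n) else i div n)"
        "Suc i mod n = (if Suc (i mod n) = n then 0 else Suc (i mod n))"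
        by (auto simp: div_Suc mod_Suc)
      show ?case using 6(1-3) s' by (auto simp: less_Suc_eq dm)
    qed (use s2 s2' in \<open>auto simp: unchanged_def\<close>)
  qed
qed

definition "output b = compute_bounds b ;; stretch ;; append_blocks ;;
  Assign 0 (Plus (Const (b + b)) (Reg rd))"

lemma run_output:
  assumes pr: "prepared n E m x s" and "regs s rB = 2 * m" and good: "good_digits m x E d X"
    and X: "arrays s aX = X" "\<And>k. m > 0 \<Longrightarrow> X k < 2 * m"
    and "regs s rd = d" and x: "\<And>p. p < m \<Longrightarrow> x p < n"
    and rep: "represents n E' b (\<lambda>j v. arrays s 0 (j * n + v)) (\<lambda>j v. arrays s 1 (j * n + v))"
    and E': "\<And>u v. u < n \<Longrightarrow> v < n \<Longrightarrow> u \<noteq> v \<Longrightarrow> \<not> (u \<in> x ` {..<m} \<and> v \<in> x ` {..<m}) \<Longrightarrow>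
      {u, v} \<in> E' \<longleftrightarrow> {u, v} \<in> E"
  shows "run (output b) (b * 12 + b * n * 73 + d * 12 + d * n * 60 + 100) s (\<lambda>s'. regs s' 0 = b + b + d \<and>
    represents n E (b + b + d) (\<lambda>j v. arrays s' 0 (j * n + v)) (\<lambda>j v. arrays s' 1 (j * n + v)))"
proof -
  define pos where "pos = arrays s apos"
  have pos: "position_of m x pos" and rn: "regs s rn = n" and rm: "regs s rm = m"
    using pr by (auto simp: prepared_def pos_def)
  let ?bn = "b * n"
  obtain t1 s1 where e1: "exec (compute_bounds b) s t1 s1" "t1 \<le> b * 12 + ?bn * 13 + 16"
    and q1: "regs s1 rbn = ?bn \<and> (\<forall>k<?bn. arrays s1 1 k \<le> regs s1 rR)"
    and u1: "unchanged (compute_bounds b) s s1"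
    using run_compute_bounds[OF rn] by (rule runE)
  note u1 = u1[unfolded unchanged_def, simplified]
  have "run stretch (?bn * 60 + 20) s1 (\<lambda>s'. \<forall>k<?bn.
    arrays s' 0 k = (if pos (k mod n) = 0 then arrays s1 0 k else 0) \<and> arrays s' 1 k = arrays s1 1 k \<and>
    arrays s' 0 (?bn + k) = arrays s1 0 k \<and>
    arrays s' 1 (?bn + k) = (if pos (k mod n) = 0 then arrays s1 1 k else regs s1 rR))"
    by (rule run_stretch) (use rn q1 u1 in \<open>auto simp: pos_def\<close>)
  then obtain t2 s2 where e2: "exec stretch s1 t2 s2" "t2 \<le> ?bn * 60 + 20"
    and q2: "\<forall>k<?bn.
    arrays s2 0 k = (if pos (k mod n) = 0 then arrays s1 0 k else 0) \<and> arrays s2 1 k = arrays s1 1 k \<and>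
    arrays s2 0 (?bn + k) = arrays s1 0 k \<and>
    arrays s2 1 (?bn + k) = (if pos (k mod n) = 0 then arrays s1 1 k else regs s1 rR)"
    and u2: "unchanged stretch s1 s2" by (rule runE)
  note u2 = u2[unfolded unchanged_def, simplified]
  have "run append_blocks (d * 12 + d * n * 60 + 30) s2 (\<lambda>s'.
    (\<forall>k<?bn + ?bn. arrays s' 0 k = arrays s2 0 k \<and> arrays s' 1 k = arrays s2 1 k) \<and>
    (\<forall>k<d * n. arrays s' 0 (?bn + ?bn + k) =
        (if pos (k mod n) = 0 then 0 else X (k div n * (2 * m) + (pos (k mod n) - 1))) \<and>
      arrays s' 1 (?bn + ?bn + k) =
        (if pos (k mod n) = 0 then 2 * m + 2 * m
         else X (k div n * (2 * m) + (pos (k mod n) - 1)) + X (k div n * (2 * m) + (pos (k mod n) - 1) + m))))"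
    by (rule run_append_blocks) (use rn rm q1 u1 u2 assms in \<open>auto simp: pos_def\<close>)
  then obtain t3 s3 where e3: "exec append_blocks s2 t3 s3" "t3 \<le> d * 12 + d * n * 60 + 30"
    and q3: "\<forall>k<?bn + ?bn. arrays s3 0 k = arrays s2 0 k \<and> arrays s3 1 k = arrays s2 1 k"
    "\<forall>k<d * n. arrays s3 0 (?bn + ?bn + k) =
        (if pos (k mod n) = 0 then 0 else X (k div n * (2 * m) + (pos (k mod n) - 1))) \<and>
      arrays s3 1 (?bn + ?bn + k) =
        (if pos (k mod n) = 0 then 2 * m + 2 * m
         else X (k div n * (2 * m) + (pos (k mod n) - 1)) + X (k div n * (2 * m) + (pos (k mod n) - 1) + m))"
    and u3: "unchanged append_blocks s2 s3" by (auto elim: runE)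
  note u3 = u3[unfolded unchanged_def, simplified]
  let ?c = "Assign 0 (Plus (Const (b + b)) (Reg rd))"
  define s4 where "s4 = result ?c s3"
  have "run ?c 4 s3 (\<lambda>s'. s' = s4)" by (rule run_loop_free) (auto simp: s4_def)
  then obtain t4 where e4: "exec ?c s3 t4 s4" "t4 \<le> 4" by (auto elim: runE)
  have s4: "regs s4 0 = b + b + d" "arrays s4 = arrays s3"
    using u1 u2 u3 assms by (simp_all add: s4_def)
  have "exec (output b) s (t1 + (t2 + (t3 + t4))) s4"
    unfolding output_def using e1 e2 e3 e4 by (intro exec.Seq)
  moreover have "t1 + (t2 + (t3 + t4)) \<le> b * 12 + b * n * 73 + d * 12 + d * n * 60 + 100"
    using e1 e2 e3 e4 by simp
  moreover have "represents n E (b + b + d) (\<lambda>j v. arrays s4 0 (j * n + v)) (\<lambda>j v. arrays s4 1 (j * n + v))"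
  proof -
    let ?W = "x ` {..<m}"
    let ?l = "\<lambda>j v. X (j * (2 * m) + (pos v - 1))"
    let ?r = "\<lambda>j v. X (j * (2 * m) + (pos v - 1)) + X (j * (2 * m) + (pos v - 1) + m)"
    have W: "pos v = 0 \<longleftrightarrow> v \<notin> ?W" for v using pos by (simp add: position_of_def)
    have posW: "pos v - 1 < m" "x (pos v - 1) = v" if "v \<in> ?W" for v
      using pos that W[of v] by (force simp: position_of_def)+
    have idx: "j * n + v < c * n" if "j < c" "v < n" for j v c
    proof -
      have "Suc j * n \<le> c * n" using that by (intro mult_le_mono1) simp
      then show ?thesis using that by simp
    qed
    have a: "arrays s1 0 = arrays s 0" "arrays s1 1 = arrays s 1" using u1 by simp_all
    have low: "arrays s4 0 (j * n + v) = (if v \<in> ?W then 0 else arrays s 0 (j * n + v))"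
      "arrays s4 0 ((b + j) * n + v) = arrays s 0 (j * n + v)"
      "arrays s4 1 (j * n + v) = arrays s 1 (j * n + v)"
      "arrays s4 1 ((b + j) * n + v) = (if v \<in> ?W then regs s1 rR else arrays s 1 (j * n + v))"
      if "j < b" "v < n" for j v
    proof -
      define k where "k = j * n + v"
      have k: "k < ?bn" "k mod n = v" using idx that by (simp_all add: k_def)
      have eq: "j * n + v = k" "(b + j) * n + v = ?bn + k" by (simp_all add: k_def algebra_simps)
      have "arrays s3 0 k = arrays s2 0 k" "arrays s3 1 k = arrays s2 1 k"
        "arrays s3 0 (?bn + k) = arrays s2 0 (?bn + k)" "arrays s3 1 (?bn + k) = arrays s2 1 (?bn + k)"
        using q3(1) k(1) by simp_all
      with q2[rule_format, OF k(1)]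
      show "arrays s4 0 (j * n + v) = (if v \<in> ?W then 0 else arrays s 0 (j * n + v))"
        "arrays s4 0 ((b + j) * n + v) = arrays s 0 (j * n + v)"
        "arrays s4 1 (j * n + v) = arrays s 1 (j * n + v)"
        "arrays s4 1 ((b + j) * n + v) = (if v \<in> ?W then regs s1 rR else arrays s 1 (j * n + v))"
        unfolding eq by (simp_all add: s4 a W k(2) del: One_nat_def)
    qed
    have high: "arrays s4 0 ((b + b + j) * n + v) = (if v \<in> ?W then ?l j v else 0)"
      "arrays s4 1 ((b + b + j) * n + v) = (if v \<in> ?W then ?r j v else 2 * m + 2 * m)"
      if "j < d" "v < n" for j v
    proof -
      define k where "k = j * n + v"
      have k: "k < d * n" "k mod n = v" "k div n = j" using idx that by (simp_all add: k_def)
      have eq: "(b + b + j) * n + v = ?bn + ?bn + k" by (simp add: k_def algebra_simps)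
      from q3(2)[rule_format, OF k(1)]
      show "arrays s4 0 ((b + b + j) * n + v) = (if v \<in> ?W then ?l j v else 0)"
        "arrays s4 1 ((b + b + j) * n + v) = (if v \<in> ?W then ?r j v else 2 * m + 2 * m)"
        unfolding eq by (simp_all add: s4 W k(2,3) del: One_nat_def)
    qed
    show ?thesis
    proof (rule represents_combine[OF rep, where W = ?W and lW = ?l and rW = ?r and R = "regs s1 rR"
          and S = "2 * m + 2 * m"])
      show "arrays s 1 (j * n + v) \<le> regs s1 rR" if "j < b" "v < n" for j v
        using q1 idx[OF that] by (simp add: a del: One_nat_def)
      show "{u, v} \<in> E' \<longleftrightarrow> {u, v} \<in> E"
        if "u < n" "v < n" "u \<noteq> v" "\<not> (u \<in> ?W \<and> v \<in> ?W)" for u v using E' that by blast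
      show "{u, v} \<in> E \<longleftrightarrow> (\<forall>j<d. ?l j u \<le> ?r j v \<and> ?l j v \<le> ?r j u)"
        if "u \<in> ?W" "v \<in> ?W" "u \<noteq> v" for u v
        \<comment> \<open>\<open>pos\<close> selects one position per vertex;
          \<open>good_digits\<close> speaks of all positions of distinct vertices, so any selection
          works.\<close>
        using good[unfolded good_digits_def, rule_format, of "pos u - 1" "pos v - 1"]
          posW[OF that(1)] posW[OF that(2)] that(3) by (simp add: add_ac)
      show "?l j v \<le> ?r j v \<and> ?r j v \<le> 2 * m + 2 * m" if "j < d" "v \<in> ?W" for j v
      proof -
        have "m > 0" using that by auto
        then show ?thesis using X(2)[of "j * (2 * m) + (pos v - 1)"]
          X(2)[of "j * (2 * m) + (pos v - 1) + m"] by simp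
      qed
    qed (use low high in auto)
  qed
  ultimately show ?thesis unfolding run_def using s4(1) by blast
qed

end

section \<open>Total running time\<close>

text \<open>In the larger base \<open>2 * m + 2\<close> the cube of the base dominates the
  polynomial costs even for \<open>m = 0\<close>; this is the 3 in the exponent, and
  \<open>8 * k\<^sup>2\<close> is \<open>2 * m\<^sup>2\<close> at \<open>m = 2 * k\<close>. The
  summand \<open>300 * (m * m)\<close> is the share of the other phases.\<close>

lemma search_time_le:
  assumes "m \<le> 2 * k"
  shows "fresh_names.search_time m + 300 * (m * m) \<le> 60 * (4 * k + 2) ^ (8 * k\<^sup>2 + 3)"
proof -
  let ?Y = "2 * m + 2"
  let ?e = "m * (2 * m)"
  \<comment> \<open>With cube and square as atoms the comparisons below are linear.\<close>
  define c q where "c = m * m * m" and "q = m * m"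
  have cube: "?Y ^ 3 = 8 * c + 24 * q + 24 * m + 8"
    by (simp add: c_def q_def power3_eq_cube algebra_simps)
  have ct: "fresh_names.check_time m = 50 * c + 58 * q + 14 * m + 8"
    by (simp add: c_def q_def fresh_names.check_time_def algebra_simps)
  have e: "?e = 2 * q" by (simp add: q_def)
  have 1: "?e * 27 + 12 + fresh_names.check_time m \<le> 10 * ?Y ^ 3" unfolding cube ct e by simp
  have 2: "m * 12 + 20 + fresh_names.check_time m + 300 * (m * m) \<le> 50 * ?Y ^ 3"
    unfolding cube ct q_def[symmetric] by simp
  have "(2 * m) ^ ?e * (?e * 27 + 12 + fresh_names.check_time m) \<le> ?Y ^ ?e * (10 * ?Y ^ 3)"
    using 1 by (intro mult_le_mono power_mono) auto
  moreover have "50 * ?Y ^ 3 \<le> ?Y ^ ?e * (50 * ?Y ^ 3)"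
    using mult_le_mono1[OF one_le_power[of ?Y ?e], of "50 * ?Y ^ 3"] by (simp only: mult_1 le_add2)
  ultimately have "fresh_names.search_time m + 300 * (m * m) \<le> 60 * (?Y ^ ?e * ?Y ^ 3)"
    using 2 unfolding fresh_names.search_time_def by (simp only: distrib_left)
  also have "\<dots> = 60 * ?Y ^ (?e + 3)" by (simp add: power_add)
  also have "?Y ^ (?e + 3) \<le> (4 * k + 2) ^ (?e + 3)" using assms by (intro power_mono) auto
  also have "(4 * k + 2) ^ (?e + 3) \<le> (4 * k + 2) ^ (8 * k\<^sup>2 + 3)"
  proof (intro power_increasing)
    have "m * m \<le> (2 * k) * (2 * k)" using assms by (intro mult_le_mono) auto
    then show "?e + 3 \<le> 8 * k\<^sup>2 + 3" by (simp add: power2_eq_square)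
  qed simp
  finally show ?thesis by simp
qed

text \<open>The exponent is the logarithm of the time bound, so that \<open>2 powr\<close> gives the
  bound back exactly. The comparison function is 0 for \<open>k\<close> at most 1, which an
  asymptotic statement ignores.\<close>

lemma exponent_bigo:
  "(\<lambda>k::nat. log 2 (real (60 * (4 * k + 2) ^ (8 * k\<^sup>2 + 3)))) \<in> O(\<lambda>k. real k ^ 2 * log 2 (real k))"
proof -
  have "log 2 (real (60 * (4 * k + 2) ^ (8 * k\<^sup>2 + 3))) =
    log 2 60 + (8 * real k ^ 2 + 3) * log 2 (4 * real k + 2)" for k :: nat
    by (simp add: log_mult log_nat_power add_pos_pos add.commute)
  moreover have "(\<lambda>k::nat. log 2 60 + (8 * real k ^ 2 + 3) * log 2 (4 * real k + 2))
      \<in> O(\<lambda>k. real k ^ 2 * log 2 (real k))"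
    by real_asymp
  ultimately show ?thesis by simp
qed

lemma total_time_le:
  fixes n len m b d :: nat
  assumes "m = 2 * len" "d \<le> m"
  shows "120 * (n * n + n + len + 1) + (m * (2 * m) * 40 + 20) +
      (b * 12 + b * n * 73 + d * 12 + d * n * 60 + 100) \<le> (400 + 100 * b) * (n * n + 1) + 300 * (m * m)"
proof -
  have nn: "n \<le> n * n" by (cases n) auto
  have mm: "m \<le> m * m" by (cases m) auto
  define p q r w z where "p = n * n" and "q = m * m" and "r = d * n" and "w = b * n" and "z = b * (n * n)"
  \<comment> \<open>The term mixed in \<open>n\<close> and \<open>k\<close>, namely
    \<open>d * n\<close>, is shared out between the quadratic part in \<open>n\<close> and the part
    that the exponential absorbs.\<close>
  have "m * n \<le> n * n + m * m"
    by (cases "m \<le> n") (auto intro: trans_le_add1 trans_le_add2 mult_le_mono)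
  moreover have "d * n \<le> m * n" using assms by simp
  ultimately have r: "r \<le> p + q" unfolding p_def q_def r_def by linarith
  have w: "w \<le> z" using nn by (simp add: w_def z_def)
  have "120 * (n * n + n + len + 1) + (m * (2 * m) * 40 + 20) +
      (b * 12 + b * n * 73 + d * 12 + d * n * 60 + 100) =
    120 * p + 120 * n + 60 * m + 240 + 80 * q + 12 * b + 73 * w + 12 * d + 60 * r"
    using assms(1) by (simp add: p_def q_def r_def w_def)
  also have "\<dots> \<le> 400 * p + 400 + 100 * z + 100 * b + 300 * q"
    using r w nn[folded p_def] mm[folded q_def] assms(2) by simp
  also have "\<dots> = (400 + 100 * b) * (n * n + 1) + 300 * (m * m)"
    by (simp add: p_def q_def z_def algebra_simps)
  finally show ?thesis .
qed

section \<open>The complete program\<close>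

theorem theorem2:
  fixes b :: nat and F :: "nat graph set" and A :: com and T :: "nat \<Rightarrow> nat"
  assumes "\<forall>G'\<in>F. simple_graph G'"
    and "\<forall>G'\<in>F. boxicity G' \<le> b"
    and "computes_box_reps A b F T"
  shows "\<exists>P :: com. \<exists>g \<in> O(\<lambda>n::nat. real n ^ 2). \<exists>f \<in> O(\<lambda>k::nat. real k ^ 2 * log 2 (real k)).
    \<forall>n k1 k2 E M ps.
      ({..<n}, E) \<in> edit_family F k1 k2 \<longrightarrow>
      is_modulator F k1 k2 ({..<n}, E) M \<longrightarrow>
      lists_pairs ps M \<longrightarrow>
      (\<exists>t s B. exec P (graph_pairs_input n E ps) t s \<and>
         outputs_interval_graphs n s B \<and>
         box_representation ({..<n}, E) B \<and>
         length B \<le> boxicity ({..<n}, E) + 2 * b \<and>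
         real t \<le> real (T n) + g n + 2 powr f (k1 + k2))"
proof -
  \<comment> \<open>At least 2, so that agreement below \<open>K\<close> includes the arrays 0 and 1
    with the output of the given program.\<close>
  define K where "K = max 2 (name_bound A)"
  have K: "2 \<le> K" "name_bound A \<le> K" by (simp_all add: K_def)
  interpret fresh_names K .
  \<comment> \<open>The program depends on \<open>A\<close> and \<open>b\<close> only, so it is
    uniform in \<open>k1\<close> and \<open>k2\<close>.\<close>
  define P where "P = prepare ;; A ;; search ;; count_blocks ;; output b"
  define g where "g n = real ((400 + 100 * b) * (n * n + 1))" for n :: nat
  define f where "f k = log 2 (real (60 * (4 * k + 2) ^ (8 * k\<^sup>2 + 3)))" for k :: nat
  have g: "g \<in> O(\<lambda>n. real n ^ 2)" unfolding g_def by (simp add: algebra_simps) real_asymp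
  have f: "f \<in> O(\<lambda>k. real k ^ 2 * log 2 (real k))" unfolding f_def by (rule exponent_bigo)
  have "\<exists>t s B. exec P (graph_pairs_input n E ps) t s \<and>
         outputs_interval_graphs n s B \<and>
         box_representation ({..<n}, E) B \<and>
         length B \<le> boxicity ({..<n}, E) + 2 * b \<and>
         real t \<le> real (T n) + g n + 2 powr f (k1 + k2)"
    if edit: "({..<n}, E) \<in> edit_family F k1 k2" and mod: "is_modulator F k1 k2 ({..<n}, E) M"
      and lists: "lists_pairs ps M" for n k1 k2 E M ps
  proof -
    define m where "m = 2 * length ps"
    define x where "x = listed_vertex ps"
    have simple: "simple_graph ({..<n}, E)" using edit by (simp add: edit_family_def)
    from mod obtain E1 E2 where M: "M = E1 \<union> E2" "E1 \<subseteq> E" "card E1 \<le> k1"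
      "E2 \<subseteq> all_pairs {..<n} - E" "card E2 \<le> k2" and F: "({..<n}, (E \<union> E2) - E1) \<in> F"
      unfolding is_modulator_def by auto
    have E': "(E \<union> E2) - E1 = toggle E M" using M by (auto simp: toggle_def)
    have MV: "M \<subseteq> all_pairs {..<n}" using M simple by (auto simp: simple_graph_def)
    have dist: "distinct (map (\<lambda>(u, v). {u, v}) ps)" and img: "(\<lambda>(u, v). {u, v}) ` set ps = M"
      using lists by (auto simp: lists_pairs_def)
    have pair: "u < n \<and> v < n \<and> u \<noteq> v" if "(u, v) \<in> set ps" for u v
    proof -
      have "{u, v} \<in> M" using img that by force
      then have "{u, v} \<in> all_pairs {..<n}" using MV by blast
      then show ?thesis by (auto simp: all_pairs_def card_insert_if split: if_splits)
    qed
    have len: "length ps \<le> k1 + k2"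
    proof -
      have "length ps = card M" using distinct_card[OF dist] img by simp
      also have "\<dots> \<le> k1 + k2" using M card_Un_le[of E1 E2] by simp
      finally show ?thesis .
    qed
    have x: "x p < n" if "p < m" for p
    proof (cases "p < length ps")
      case True
      then show ?thesis using pair[of "fst (ps ! p)" "snd (ps ! p)"] by (simp add: x_def listed_vertex_def)
    next
      case False
      then have "p - length ps < length ps" using that by (simp add: m_def)
      then show ?thesis using False pair[of "fst (ps ! (p - length ps))" "snd (ps ! (p - length ps))"]
        by (simp add: x_def listed_vertex_def)
    qed
    have covered: "u \<in> x ` {..<m} \<and> v \<in> x ` {..<m}" if uv: "{u, v} \<in> M" for u v
    proof -
      obtain i where i: "i < length ps" "{fst (ps ! i), snd (ps ! i)} = {u, v}"
        using uv unfolding img[symmetric] by (force simp: in_set_conv_nth)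
      have "x i = fst (ps ! i)" "x (length ps + i) = snd (ps ! i)"
        using i by (simp_all add: x_def listed_vertex_def)
      moreover have "i < m" "length ps + i < m" using i by (simp_all add: m_def)
      ultimately have "fst (ps ! i) \<in> x ` {..<m}" "snd (ps ! i) \<in> x ` {..<m}" by (metis imageI lessThan_iff)+
      then show ?thesis using i(2) by (auto simp: doubleton_eq_iff)
    qed
    obtain t1 s1 where e1: "exec prepare (graph_pairs_input n E ps) t1 s1"
        "t1 \<le> 120 * (n * n + n + length ps + 1)"
      and q1: "agree_below K s1 (graph_input n (toggle E M)) \<and> prepared n E m x s1 \<and>
        arrays s1 aX = (\<lambda>_. 0)"
      using run_prepare[OF dist pair, of E] unfolding img m_def x_def by (rule runE)
    then have agree: "agree_below K s1 (graph_input n (toggle E M))"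
      and pr1: "prepared n E m x s1" and X1: "arrays s1 aX = (\<lambda>_. 0)" by simp_all
    from assms(3) F obtain tA sA BA where A: "exec A (graph_input n (toggle E M)) tA sA" "tA \<le> T n"
      and out: "outputs_interval_graphs n sA BA" "box_representation ({..<n}, toggle E M) BA" "length BA = b"
      unfolding computes_box_reps_def E' by blast
    have "agree_below K (graph_input n (toggle E M)) s1" using agree by (simp add: agree_below_def)
    from exec_agree[OF A(1) K(2) this] obtain s2
      where e2: "exec A s1 tA s2" and agree2: "agree_below K sA s2" by blast
    have unch: "regs s2 y = regs s1 y" "arrays s2 y = arrays s1 y" if "K \<le> y" for y
      using exec_unchanged[OF e2] that written_below[OF K(2)] by (auto simp: unchanged_def not_less[symmetric])
    have pr2: "prepared n E m x s2" and X2: "arrays s2 aX = (\<lambda>_. 0)"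
      using pr1 X1 by (simp_all add: prepared_def unch)
    have arr2: "arrays s2 0 = arrays sA 0" "arrays s2 1 = arrays sA 1"
      using agree2 K(1) by (auto simp: agree_below_def)
    have simple': "simple_graph ({..<n}, toggle E M)" using assms(1) F E' by auto
    have b: "regs sA 0 = b" using out by (auto simp: outputs_interval_graphs_def)
    have rep2: "represents n (toggle E M) b (\<lambda>j v. arrays s2 0 (j * n + v)) (\<lambda>j v. arrays s2 1 (j * n + v))"
      using out box_representation_iff_represents[OF simple',
        of b "\<lambda>j v. arrays sA 0 (j * n + v)" "\<lambda>j v. arrays sA 1 (j * n + v)"]
      by (simp add: outputs_interval_graphs_def b arr2 del: One_nat_def)
    obtain t3 s3 where e3: "exec search s2 t3 s3" "t3 \<le> search_time m"
      and q3: "\<exists>N. searched m x E N s3 \<and> good_digits m x E m (digit (2 * m) N)"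
      and u3: "unchanged search s2 s3"
      using run_search[OF pr2 x X2] by (rule runE)
    obtain N where N: "searched m x E N s3" "good_digits m x E m (digit (2 * m) N)" using q3 by blast
    let ?X = "digit (2 * m) N"
    have s3: "regs s3 rB = 2 * m" "regs s3 rL = m * (2 * m)" "arrays s3 aX = ?X"
      using N(1) by (auto simp: searched_def)
    have pr3: "prepared n E m x s3" by (rule prepared_unchanged[OF pr2 u3]) auto
    have "run count_blocks (m * (2 * m) * 40 + 20) s3
      (\<lambda>s'. (\<forall>k<m * (2 * m). regs s' rd * (2 * m) \<le> k \<longrightarrow> ?X k = 0) \<and>
       (\<forall>d. (\<forall>k\<ge>d * (2 * m). ?X k = 0) \<longrightarrow> regs s' rd \<le> d))"
      by (rule run_count_blocks) (use s3 in auto)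
    then obtain t4 s4 where e4: "exec count_blocks s3 t4 s4" "t4 \<le> m * (2 * m) * 40 + 20"
      and q4: "(\<forall>k<m * (2 * m). regs s4 rd * (2 * m) \<le> k \<longrightarrow> ?X k = 0) \<and>
       (\<forall>d. (\<forall>k\<ge>d * (2 * m). ?X k = 0) \<longrightarrow> regs s4 rd \<le> d)"
      and u4: "unchanged count_blocks s3 s4" by (rule runE)
    define d where "d = regs s4 rd"
    obtain B0 where B0: "box_representation ({..<n}, E) B0" using ex_box_representation[OF simple] by blast
    obtain d0 where d0: "d0 \<le> m" "d0 \<le> boxicity ({..<n}, E)" "\<forall>i\<ge>d0 * (2 * m). ?X i = 0"
      using least_good_digits_zero[OF B0, of m x N] x N(1) by (auto simp: searched_def)
    \<comment> \<open>The least good number fits into \<open>d0\<close> blocks and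
      \<open>count_blocks\<close> finds the fewest, so \<open>d\<close> is at most the
      boxicity.\<close>
    have d: "d \<le> d0" using q4 d0(3) by (simp add: d_def)
    have zero: "?X k = 0" if "d * (2 * m) \<le> k" for k
    proof (cases "k < m * (2 * m)")
      case True
      then show ?thesis using q4 that by (simp add: d_def)
    next
      case False
      \<comment> \<open>\<open>count_blocks\<close> inspects only the first
        \<open>m * (2 * m)\<close> digits; those beyond vanish because
        \<open>d0 \<le> m\<close>.\<close>
      then have "d0 * (2 * m) \<le> k" using d0(1) by (meson le_trans mult_le_mono1 not_less)
      then show ?thesis using d0(3) by blast
    qed
    have good: "good_digits m x E d ?X"
      using good_digits_zero_blocks[of d m m ?X x E] zero d d0(1) N(2) by simp
    have pr4: "prepared n E m x s4" by (rule prepared_unchanged[OF pr3 u4]) auto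
    have s4: "regs s4 rB = 2 * m" "arrays s4 aX = ?X" using s3 u4 by (simp_all add: unchanged_def)
    have arr4: "arrays s4 0 = arrays s2 0" "arrays s4 1 = arrays s2 1"
      using u3 u4 by (simp_all add: unchanged_def del: One_nat_def)
    have "run (output b) (b * 12 + b * n * 73 + d * 12 + d * n * 60 + 100) s4 (\<lambda>s'. regs s' 0 = b + b + d \<and>
      represents n E (b + b + d) (\<lambda>j v. arrays s' 0 (j * n + v)) (\<lambda>j v. arrays s' 1 (j * n + v)))"
    proof (rule run_output[OF pr4 s4(1) good s4(2)])
      show "?X k < 2 * m" if "m > 0" for k using that by (simp add: digit_def)
      show "regs s4 rd = d" by (simp add: d_def)
      show "represents n (toggle E M) b (\<lambda>j v. arrays s4 0 (j * n + v)) (\<lambda>j v. arrays s4 1 (j * n + v))"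
        using rep2 unfolding arr4 .
      show "{u, v} \<in> toggle E M \<longleftrightarrow> {u, v} \<in> E" if "\<not> (u \<in> x ` {..<m} \<and> v \<in> x ` {..<m})" for u v
        using covered[of u v] that by (auto simp: toggle_def)
    qed (use x in auto)
    then obtain t5 s5 where e5: "exec (output b) s4 t5 s5"
        "t5 \<le> b * 12 + b * n * 73 + d * 12 + d * n * 60 + 100"
      and q5: "regs s5 0 = b + b + d \<and>
      represents n E (b + b + d) (\<lambda>j v. arrays s5 0 (j * n + v)) (\<lambda>j v. arrays s5 1 (j * n + v))"
      by (rule runE)
    define B where "B = map (\<lambda>j. intersection_graph {..<n} (\<lambda>v. real (arrays s5 0 (j * n + v)))
                (\<lambda>v. real (arrays s5 1 (j * n + v)))) [0..<b + b + d]"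
    let ?t = "t1 + (tA + (t3 + (t4 + t5)))"
    have "exec P (graph_pairs_input n E ps) ?t s5"
      unfolding P_def using e1 e2 e3 e4 e5 by (intro exec.Seq)
    moreover have "outputs_interval_graphs n s5 B"
      using q5 by (simp add: outputs_interval_graphs_def B_def represents_def del: upt_Suc One_nat_def)
    moreover have "box_representation ({..<n}, E) B"
      unfolding B_def using q5 represents_imp_box_representation[OF simple] by blast
    moreover have "length B \<le> boxicity ({..<n}, E) + 2 * b" using d d0(2) by (simp add: B_def)
    moreover have "real ?t \<le> real (T n) + g n + 2 powr f (k1 + k2)"
    proof -
      have "t1 + t4 + t5 \<le> (400 + 100 * b) * (n * n + 1) + 300 * (m * m)"
        using total_time_le[OF m_def, of d n b] d d0(1) e1(2) e4(2) e5(2) by linarith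
      moreover have "search_time m + 300 * (m * m) \<le> 60 * (4 * (k1 + k2) + 2) ^ (8 * (k1 + k2)\<^sup>2 + 3)"
        using len by (intro search_time_le) (simp add: m_def)
      ultimately have "?t \<le> T n + (400 + 100 * b) * (n * n + 1) +
          60 * (4 * (k1 + k2) + 2) ^ (8 * (k1 + k2)\<^sup>2 + 3)"
        using A(2) e3(2) by linarith
      then have "real ?t \<le> real (T n + (400 + 100 * b) * (n * n + 1) +
          60 * (4 * (k1 + k2) + 2) ^ (8 * (k1 + k2)\<^sup>2 + 3))" by (simp only: of_nat_le_iff)
      also have "\<dots> = real (T n) + g n + real (60 * (4 * (k1 + k2) + 2) ^ (8 * (k1 + k2)\<^sup>2 + 3))"
        by (simp only: g_def of_nat_add)
      also have "real (60 * (4 * (k1 + k2) + 2) ^ (8 * (k1 + k2)\<^sup>2 + 3)) = 2 powr f (k1 + k2)"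
        unfolding f_def by (rule powr_log_cancel[symmetric]) auto
      finally show ?thesis .
    qed
    ultimately show ?thesis by blast
  qed
  then show ?thesis using g f by blast
qed

end
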